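(* Let $\mathrm{GBI}$ denote generalized backward induction (defined in the context) with any fixed choice of the solver that selects a social-welfare optimal equilibrium of each induced normal-form game. Then: (Nash) for every real $M>0$ there exist an NS-CSG $\mathsf{C}$ with rewards $r$, a horizon $K$ and an initial state $s\in S$ such that, if $\sigma$ is the SPNE returned by GBI for equilibrium type NE from $s$ and $\sigma^*$ is an SW-SPNE for $s$, then $W_{0,s}^{\sigma^*}-W_{0,s}^{\sigma}>M$; (Correlated) for every real $M>0$ there exist an NS-CSG $\mathsf{C}$ with rewards $r$, a horizon $K$ and an initial state $s\in S$ such that, if $\tau$ is the SPCE returned by GBI for equilibrium type CE from $s$ and $\tau^*$ is an SW-SPCE for $s$, then $W_{0,s}^{\tau^*}-W_{0,s}^{\tau}>M$. That is, the social welfare gap between an SW-SPNE (resp. SW-SPCE) and the equilibrium obtained by GBI can be positive and is unbounded over games.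
   Context: **NS-CSG.** A neuro-symbolic concurrent stochastic game (NS-CSG) $\mathsf{C}$ consists of agents $\mathsf{Ag}_i=(S_i,A_i,\Delta_i,\mathit{obs}_i,\delta_i)$, $i\in N=\{1,\dots,n\}$, and an environment $E=(S_E,\delta_E)$, where: $S_i=\mathit{Loc}_i\times \mathit{Per}_i$ with $\mathit{Loc}_i\subseteq\mathbb{R}^{b_i}$, $\mathit{Per}_i\subseteq\mathbb{R}^{d_i}$ finite (local states and percepts); $S_E\subseteq\mathbb{R}^e$ is a finite or infinite set; $A_i$ is a nonempty finite action set, and $A=(A_1\cup\{\bot\})\times\cdots\times(A_n\cup\{\bot\})$ is the set of joint actions with $\bot\notin\bigcup_i A_i$ an idle action; $\Delta_i:S_i\to 2^{A_i}$ gives available actions; $\mathit{obs}_i:S_1\times\cdots\times S_n\times S_E\to \mathit{Per}_i$ is an observation function (implemented by a neural network classifier; for the present purposes just a function); $\delta_i:S_i\times A\to\mathbb{P}(\mathit{Loc}_i)$ is a probabilistic transition function, where $\mathbb{P}(X)$ is the set of probability distributions on $X$; $\delta_E:S_E\times A\to S_E$ is a deterministic environment transition function. The set of global states is $S=S_1\times\cdots\times S_n\times S_E$. For $s=(s_1,\dots,s_n,s_E)\in S$ with $s_i=(\mathit{loc}_i,\mathit{per}_i)$, let $A_i(s)=\Delta_i(s_i)$ if this is nonempty and $A_i(s)=\{\bot\}$ otherwise, and $A(s)=A_1(s)\times\cdots\times A_n(s)$. For $\alpha\in A(s)$, writing $\mathit{per}_i'=\mathit{obs}_i(s)$, the next state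 is $s'=((\mathit{loc}_1',\mathit{per}_1'),\dots,(\mathit{loc}_n',\mathit{per}_n'),\delta_E(s_E,\alpha))$ with probability $\delta(s,\alpha)(s')=\prod_{i}\delta_i((\mathit{loc}_i,\mathit{per}_i'),\alpha)(\mathit{loc}_i')$, and $\delta(s,\alpha)$ is zero on all states not of this form. **Histories.** Fix a horizon $K\ge 1$. A history in stage $\ell\in\{0,\dots,K\}$ is a sequence $h=s^0\xrightarrow{\alpha^0}s^1\cdots\xrightarrow{\alpha^{\ell-1}}s^\ell$ with $\alpha^k\in A(s^k)$ and $\delta(s^k,\alpha^k)(s^{k+1})>0$; $last(h)=s^\ell$. $H^\ell$ (resp. $H^\ell_s$) is the set of histories in stage $\ell$ (resp. with $s^0=s$), $H^{<K}=\bigcup_{\ell<K}H^\ell$, $H_s^{<K}=\bigcup_{\ell<K}H_s^\ell$, $H_s=H_s^{<K}\cup H_s^K$. $\mathrm{Succ}(h)$ is the set of one-stage successors of $h\in H^{<K}$. A path from $h\in H^\ell$ is a sequence $\pi=s^\ell\xrightarrow{\alpha^\ell}\cdots\xrightarrow{\alpha^{K-1}}s^K$ of positive-probability transitions with $s^\ell=last(h)$. **Profiles.** A strategy of agent $i$ is $\sigma_i:H^{<K}\to\mathbb{P}(A_i\cup\{\bot\})$ with $\sigma_i(h)$ supported on $A_i(last(h))$; $\Sigma_i^{\mathrm N}$ is the set of these; a strategy profile is $\sigma=(\sigma_1,\dots,\sigma_n)$ (agents randomise independently). $\sigma_{-i}[\sigma_i']$ is $\sigma$ with $\sigma_i$ replaced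 by $\sigma_i'$. A correlated profile is $\tau:H^{<K}\to\mathbb{P}(A)$ with $\tau(h)$ supported on $A(last(h))$. **Rewards.** Each agent has reward functions $r_i^A:S\times A\to\mathbb{R}$, $r_i^S:S\to\mathbb{R}$. For a path $\pi$ from stage $\ell$, $Y_i(\pi)=\sum_{k=\ell}^{K-1}\big(r_i^A(s^k,\alpha^k)+r_i^S(s^k)\big)+r_i^S(s^K)$. $\mathbb{E}^{\sigma}_{\ell,h}[Y_i]$ (resp. $\mathbb{E}^\tau_{\ell,h}[Y_i]$) is the expectation of $Y_i$ over paths from $h\in H^\ell$ under $\sigma$ (resp. $\tau$). $\mathbb{E}^\tau_\ell[Y_i,a_i'\mid a_i,h]$ is the expectation of $Y_i$ from $h\in H^\ell$ conditional on $\tau(h)$ having recommended $a_i$ to agent $i$, when agent $i$ plays $a_i'$ at $h$ and otherwise all agents follow the recommendations of $\tau$ (at $h$ and afterwards). **Equilibria.** For an initial state $s$: $\sigma^*$ is a subgame-perfect Nash equilibrium (SPNE) if $\mathbb{E}^{\sigma^*}_{\ell,h}[Y_i]\ge\mathbb{E}^{\sigma^*_{-i}[\sigma_i]}_{\ell,h}[Y_i]$ for all $\sigma_i\in\Sigma_i^{\mathrm N}$, $i\in N$, $\ell<K$ and $h\in H_s^\ell$. $\tau^*$ is a subgame-perfect correlated equilibrium (SPCE) if $\mathbb{E}^{\tau^*}_\ell[Y_i,a_i\mid a_i,h]\ge\mathbb{E}^{\tau^*}_\ell[Y_i,a_i'\mid a_i,h]$ for all $i\in N$, $\ell<K$, $h\in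 H_s^\ell$ and $a_i,a_i'\in A_i(last(h))$ (the condition being vacuous when $a_i$ is recommended with probability $0$ at $h$). **Social welfare.** $W^{\sigma}_{\ell,h}=\mathbb{E}^\sigma_{\ell,h}[\sum_i Y_i]$ and $W^{\tau}_{\ell,h}=\mathbb{E}^\tau_{\ell,h}[\sum_i Y_i]$; $W_{0,s}$ refers to the length-zero history $s$. An SPNE $\sigma^*$ for $s$ is an SW-SPNE if $W_{0,s}^{\sigma^*}\ge W_{0,s}^{\sigma}$ for all SPNEs $\sigma$ for $s$; an SPCE $\tau^*$ is an SW-SPCE if $W_{0,s}^{\tau^*}\ge W_{0,s}^{\tau}$ for all SPCEs $\tau$ for $s$. **Generalized backward induction (GBI).** Input: $\mathsf{C}$, $r$, $K$, $s$, and a type in $\{\mathrm{NE},\mathrm{CE}\}$. For $h\in H_s^K$ set $V^h=(r_1^S(last(h)),\dots,r_n^S(last(h)))$. Then for $\ell=K-1,\dots,0$ and each $h\in H_s^\ell$, form the induced normal-form game in which agent $i$ has action set $A_i(last(h))$ and utility at $\alpha\in A(last(h))$ equal to $r_i^A(last(h),\alpha)+r_i^S(last(h))+\sum_{h'}\delta(last(h),\alpha)(last(h'))\,V_i^{h'}$, the sum being over successors $h'=h\xrightarrow{\alpha}s'$ of $h$ via $\alpha$; compute an SWNE (type NE: a mixed Nash equilibrium maximising the sum of the agents' expected utilities among all Nash equilibria) or an SWCE (type CE: a correlated equilibrium maximising this sum among all correlated equilibria) $\mu^h$ of this game, and let $V^h$ be its vector of expected utilities. Output: the profile $h\mapsto\mu^h$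 on $H_s^{<K}$ and the payoffs $V=\{V^h\}_{h\in H_s}$. *)

theory Defs
  imports "HOL-Probability.Probability"
begin

section \<open>Independent products of distributions\<close>

definition joint_pmf :: "nat \<Rightarrow> (nat \<Rightarrow> 'b pmf) \<Rightarrow> 'b list pmf" where
  "joint_pmf n \<mu> = map_pmf (\<lambda>f. map f [0..<n]) (Pi_pmf {..<n} undefined \<mu>)"

lemma pmf_joint_pmf:
  "pmf (joint_pmf n \<mu>) xs = (if length xs = n then \<Prod>i<n. pmf (\<mu> i) (xs ! i) else 0)"
proof (cases "length xs = n")
  case True
  define f where "f = (\<lambda>i. if i < n then xs ! i else undefined)"
  have inj: "inj_on (\<lambda>f. map f [0..<n]) (set_pmf (Pi_pmf {..<n} undefined \<mu>))"
  proof (rule inj_onI)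
    fix g h
    assume g: "g \<in> set_pmf (Pi_pmf {..<n} undefined \<mu>)"
      and h: "h \<in> set_pmf (Pi_pmf {..<n} undefined \<mu>)"
      and eq: "map g [0..<n] = map h [0..<n]"
    have out: "k x = undefined"
      if "k \<in> set_pmf (Pi_pmf {..<n} undefined \<mu>)" "\<not> x < n" for k x
      using set_Pi_pmf_subset[of "{..<n}" undefined \<mu>] that by auto
    show "g = h"
    proof
      fix x show "g x = h x"
        using eq out[OF g, of x] out[OF h, of x] by (cases "x < n") auto
    qed
  qed
  have xs: "xs = map f [0..<n]"
    using True by (intro nth_equalityI) (auto simp: f_def)
  have val: "pmf (Pi_pmf {..<n} undefined \<mu>) f = (\<Prod>i<n. pmf (\<mu> i) (xs ! i))"
    by (subst pmf_Pi') (auto simp: f_def)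
  have "pmf (joint_pmf n \<mu>) xs = pmf (Pi_pmf {..<n} undefined \<mu>) f"
  proof (cases "f \<in> set_pmf (Pi_pmf {..<n} undefined \<mu>)")
    case True
    then show ?thesis
      unfolding joint_pmf_def xs by (rule pmf_map_inj[OF inj])
  next
    case False
    have "xs \<notin> set_pmf (joint_pmf n \<mu>)"
    proof
      assume "xs \<in> set_pmf (joint_pmf n \<mu>)"
      then obtain g where g: "g \<in> set_pmf (Pi_pmf {..<n} undefined \<mu>)" "xs = map g [0..<n]"
        by (auto simp: joint_pmf_def)
      have "g = f"
      proof
        fix x show "g x = f x"
          using g set_Pi_pmf_subset[of "{..<n}" undefined \<mu>] by (cases "x < n") (auto simp: f_def)
      qed
      with g False show False by simp
    qed
    with False show ?thesis by (simp add: set_pmf_iff)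
  qed
  with True val show ?thesis by simp
next
  case False
  then have "xs \<notin> set_pmf (joint_pmf n \<mu>)"
    by (auto simp: joint_pmf_def)
  with False show ?thesis by (simp add: set_pmf_iff)
qed


section \<open>Games\<close>

text \<open>
  Agents are numbered \<open>0, \<dots>, n - 1\<close>, and a family indexed by the agents is a list of length \<open>n\<close>.
  A point of a space of dimension \<open>d\<close> over the reals is a list of length \<open>d\<close>. Actions are named by
  natural numbers; \<^term>\<open>None\<close> is the idle action, so it is never an element of an agent's own
  action set.
\<close>

type_synonym act = "nat option"
type_synonym joint_act = "act list"
type_synonym point = "real list"
type_synonym local_state = "point \<times> point"
type_synonym gstate = "local_state list \<times> point"

record nscsg =
  agents :: nat
  loc_dim :: "nat \<Rightarrow> nat"
  per_dim :: "nat \<Rightarrow> nat"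
  env_dim :: nat
  Loc :: "nat \<Rightarrow> point set"
  Per :: "nat \<Rightarrow> point set"
  Env :: "point set"
  Act :: "nat \<Rightarrow> nat set"
  avail :: "nat \<Rightarrow> local_state \<Rightarrow> nat set"
  obs :: "nat \<Rightarrow> gstate \<Rightarrow> point"
  loc_trans :: "nat \<Rightarrow> local_state \<Rightarrow> joint_act \<Rightarrow> point pmf"
  env_trans :: "point \<Rightarrow> joint_act \<Rightarrow> point"

definition gstates :: "nscsg \<Rightarrow> gstate set" where
  "gstates C = {(ls, e). length ls = agents C \<and> (\<forall>i<agents C. ls ! i \<in> Loc C i \<times> Per C i) \<and> e \<in> Env C}"

definition joint_acts :: "nscsg \<Rightarrow> joint_act set" where
  "joint_acts C = {\<alpha>. length \<alpha> = agents C \<and> (\<forall>i<agents C. \<alpha> ! i \<in> insert None (Some ` Act C i))}"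

definition is_nscsg :: "nscsg \<Rightarrow> bool" where
  "is_nscsg C \<longleftrightarrow>
     agents C \<ge> 1 \<and>
     (\<forall>i<agents C.
        finite (Loc C i) \<and> (\<forall>x\<in>Loc C i. length x = loc_dim C i) \<and>
        finite (Per C i) \<and> (\<forall>x\<in>Per C i. length x = per_dim C i) \<and>
        finite (Act C i) \<and> Act C i \<noteq> {} \<and>
        (\<forall>q\<in>Loc C i \<times> Per C i. avail C i q \<subseteq> Act C i) \<and>
        (\<forall>s\<in>gstates C. obs C i s \<in> Per C i) \<and>
        (\<forall>q\<in>Loc C i \<times> Per C i. \<forall>\<alpha>\<in>joint_acts C. set_pmf (loc_trans C i q \<alpha>) \<subseteq> Loc C i)) \<and>
     (\<forall>x\<in>Env C. length x = env_dim C) \<and>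
     (\<forall>e\<in>Env C. \<forall>\<alpha>\<in>joint_acts C. env_trans C e \<alpha> \<in> Env C)"

definition acts_at :: "nscsg \<Rightarrow> nat \<Rightarrow> gstate \<Rightarrow> act set" where
  "acts_at C i s =
     (if avail C i (fst s ! i) = {} then {None} else Some ` avail C i (fst s ! i))"

definition joint_acts_at :: "nscsg \<Rightarrow> gstate \<Rightarrow> joint_act set" where
  "joint_acts_at C s = {\<alpha>. length \<alpha> = agents C \<and> (\<forall>i<agents C. \<alpha> ! i \<in> acts_at C i s)}"

definition next_state :: "nscsg \<Rightarrow> gstate \<Rightarrow> joint_act \<Rightarrow> gstate pmf" where
  "next_state C s \<alpha> =
     map_pmf (\<lambda>locs. (zip locs (map (\<lambda>i. obs C i s) [0..<agents C]), env_trans C (snd s) \<alpha>))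
       (joint_pmf (agents C) (\<lambda>i. loc_trans C i (fst (fst s ! i), obs C i s) \<alpha>))"

lemma pmf_next_state:
  "pmf (next_state C s \<alpha>) (ls, e) =
     (if length ls = agents C \<and> (\<forall>i<agents C. snd (ls ! i) = obs C i s) \<and> e = env_trans C (snd s) \<alpha>
      then \<Prod>i<agents C. pmf (loc_trans C i (fst (fst s ! i), obs C i s) \<alpha>) (fst (ls ! i))
      else 0)"
proof -
  define J where "J = joint_pmf (agents C) (\<lambda>i. loc_trans C i (fst (fst s ! i), obs C i s) \<alpha>)"
  define F where
    "F = (\<lambda>locs :: point list. (zip locs (map (\<lambda>i. obs C i s) [0..<agents C]), env_trans C (snd s) \<alpha>))"
  have tr: "next_state C s \<alpha> = map_pmf F J"
    by (simp add: next_state_def F_def J_def)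
  have len: "length x = agents C" if "x \<in> set_pmf J" for x
    using that by (auto simp: J_def joint_pmf_def)
  show ?thesis
  proof (cases "length ls = agents C \<and> (\<forall>i<agents C. snd (ls ! i) = obs C i s) \<and> e = env_trans C (snd s) \<alpha>")
    case True
    have eq: "F x = (ls, e) \<longleftrightarrow> x = map fst ls" if "length x = agents C" for x
    proof
      assume "F x = (ls, e)"
      then have "ls = zip x (map (\<lambda>i. obs C i s) [0..<agents C])" by (simp add: F_def)
      then show "x = map fst ls" using that by simp
    next
      assume "x = map fst ls"
      then show "F x = (ls, e)"
        using True by (auto simp: F_def intro!: nth_equalityI prod_eqI)
    qed
    have "pmf (map_pmf F J) (ls, e) = measure_pmf.prob J (F -` {(ls, e)})"
      by (rule pmf_map)
    also have "\<dots> = measure_pmf.prob J {map fst ls}"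
      using eq len by (intro measure_pmf.finite_measure_eq_AE) (auto simp: AE_measure_pmf_iff)
    also have "\<dots> = pmf J (map fst ls)"
      by (simp add: pmf.rep_eq)
    finally show ?thesis
      using True by (simp add: tr J_def pmf_joint_pmf)
  next
    case False
    have "(ls, e) \<notin> set_pmf (map_pmf F J)"
    proof
      assume "(ls, e) \<in> set_pmf (map_pmf F J)"
      then obtain x where "x \<in> set_pmf J" "F x = (ls, e)" by auto
      then show False using False len[of x] by (auto simp: F_def)
    qed
    then have "pmf (next_state C s \<alpha>) (ls, e) = 0" unfolding tr pmf_eq_0_set_pmf .
    then show ?thesis using False by (simp only: if_False)
  qed
qed


section \<open>Histories and paths\<close>

text \<open>
  Histories and paths share one representation: the first state together with the list of
  subsequent (joint action, next state) pairs.
\<close>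

type_synonym run = "gstate \<times> (joint_act \<times> gstate) list"

definition stage :: "run \<Rightarrow> nat" where
  "stage h = length (snd h)"

definition st :: "run \<Rightarrow> nat \<Rightarrow> gstate" where
  "st h k = (if k = 0 then fst h else snd (snd h ! (k - 1)))"

definition ac :: "run \<Rightarrow> nat \<Rightarrow> joint_act" where
  "ac h k = fst (snd h ! k)"

definition lst :: "run \<Rightarrow> gstate" where
  "lst h = st h (stage h)"

definition append_step :: "run \<Rightarrow> joint_act \<Rightarrow> gstate \<Rightarrow> run" where
  "append_step h \<alpha> s' = (fst h, snd h @ [(\<alpha>, s')])"

definition prefix_step :: "gstate \<Rightarrow> joint_act \<Rightarrow> run \<Rightarrow> run" where
  "prefix_step s \<alpha> \<pi> = (s, (\<alpha>, fst \<pi>) # snd \<pi>)"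

definition hist :: "nscsg \<Rightarrow> nat \<Rightarrow> run set" where
  "hist C l = {h. stage h = l \<and> (\<forall>k\<le>l. st h k \<in> gstates C) \<and>
     (\<forall>k<l. ac h k \<in> joint_acts_at C (st h k) \<and> pmf (next_state C (st h k) (ac h k)) (st h (Suc k)) > 0)}"

definition hist_from :: "nscsg \<Rightarrow> gstate \<Rightarrow> nat \<Rightarrow> run set" where
  "hist_from C s l = {h \<in> hist C l. st h 0 = s}"


section \<open>Profiles and expected rewards\<close>

definition strategies :: "nscsg \<Rightarrow> nat \<Rightarrow> nat \<Rightarrow> (run \<Rightarrow> act pmf) set" where
  "strategies C K i = {f. \<forall>l<K. \<forall>h\<in>hist C l. set_pmf (f h) \<subseteq> acts_at C i (lst h)}"

definition is_profile :: "nscsg \<Rightarrow> nat \<Rightarrow> (nat \<Rightarrow> run \<Rightarrow> act pmf) \<Rightarrow> bool" where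
  "is_profile C K \<sigma> \<longleftrightarrow> (\<forall>i<agents C. \<sigma> i \<in> strategies C K i)"

definition is_corr_profile :: "nscsg \<Rightarrow> nat \<Rightarrow> (run \<Rightarrow> joint_act pmf) \<Rightarrow> bool" where
  "is_corr_profile C K \<tau> \<longleftrightarrow>
     (\<forall>l<K. \<forall>h\<in>hist C l. set_pmf (\<tau> h) \<subseteq> joint_acts_at C (lst h))"

definition indep :: "nscsg \<Rightarrow> (nat \<Rightarrow> run \<Rightarrow> act pmf) \<Rightarrow> run \<Rightarrow> joint_act pmf" where
  "indep C \<sigma> h = joint_pmf (agents C) (\<lambda>i. \<sigma> i h)"

record rewards =
  act_rew :: "nat \<Rightarrow> gstate \<Rightarrow> joint_act \<Rightarrow> real"
  state_rew :: "nat \<Rightarrow> gstate \<Rightarrow> real"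

text \<open>
  A path from a history of stage \<open>l\<close> is indexed here from \<open>0\<close> instead of from \<open>l\<close>.
\<close>

definition total_reward :: "rewards \<Rightarrow> nat \<Rightarrow> run \<Rightarrow> real" where
  "total_reward r i \<pi> =
     (\<Sum>k<stage \<pi>. act_rew r i (st \<pi> k) (ac \<pi> k) + state_rew r i (st \<pi> k)) + state_rew r i (lst \<pi>)"

text \<open>
  The path distribution from \<open>h\<close> when the joint action at \<open>h\<close> is drawn from \<open>\<rho>\<close>, and the rest of
  the path from \<open>rest h'\<close>, where \<open>h'\<close> is the history that records the action actually played.
\<close>

definition play :: "nscsg \<Rightarrow> joint_act pmf \<Rightarrow> (run \<Rightarrow> run pmf) \<Rightarrow> run \<Rightarrow> run pmf" where
  "play C \<rho> rest h =
     bind_pmf \<rho> (\<lambda>\<alpha>.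
     bind_pmf (next_state C (lst h) \<alpha>) (\<lambda>s'.
       map_pmf (prefix_step (lst h) \<alpha>) (rest (append_step h \<alpha> s'))))"

text \<open>The distribution of the paths of \<open>m\<close> transitions from a history:\<close>

primrec paths :: "nscsg \<Rightarrow> (run \<Rightarrow> joint_act pmf) \<Rightarrow> nat \<Rightarrow> run \<Rightarrow> run pmf" where
  "paths C \<tau> 0 = (\<lambda>h. return_pmf (lst h, []))"
| "paths C \<tau> (Suc m) = (\<lambda>h. play C (\<tau> h) (paths C \<tau> m) h)"

definition expected :: "nscsg \<Rightarrow> (run \<Rightarrow> joint_act pmf) \<Rightarrow> nat \<Rightarrow> run \<Rightarrow> (run \<Rightarrow> real) \<Rightarrow> real" where
  "expected C \<tau> K h Y = measure_pmf.expectation (paths C \<tau> (K - stage h) h) Y"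

definition recommends :: "joint_act pmf \<Rightarrow> nat \<Rightarrow> act \<Rightarrow> bool" where
  "recommends \<rho> i a \<longleftrightarrow> measure_pmf.prob \<rho> {\<alpha>. \<alpha> ! i = a} > 0"

text \<open>
  Recommendations conditional on agent \<open>i\<close> having been recommended \<open>a\<close>, with \<open>i\<close> playing \<open>a'\<close>
  instead; only meaningful if \<^term>\<open>recommends \<rho> i a\<close>.
\<close>

definition deviate :: "joint_act pmf \<Rightarrow> nat \<Rightarrow> act \<Rightarrow> act \<Rightarrow> joint_act pmf" where
  "deviate \<rho> i a a' = map_pmf (\<lambda>\<alpha>. \<alpha>[i := a']) (cond_pmf \<rho> {\<alpha>. \<alpha> ! i = a})"

definition expected_dev ::
  "nscsg \<Rightarrow> (run \<Rightarrow> joint_act pmf) \<Rightarrow> nat \<Rightarrow> run \<Rightarrow> (run \<Rightarrow> real) \<Rightarrow> nat \<Rightarrow> act \<Rightarrow> act \<Rightarrow> real" where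
  "expected_dev C \<tau> K h Y i a a' =
     measure_pmf.expectation (play C (deviate (\<tau> h) i a a') (paths C \<tau> (K - stage h - 1)) h) Y"


section \<open>Subgame-perfect equilibria and social welfare\<close>

definition is_SPNE :: "nscsg \<Rightarrow> rewards \<Rightarrow> nat \<Rightarrow> gstate \<Rightarrow> (nat \<Rightarrow> run \<Rightarrow> act pmf) \<Rightarrow> bool" where
  "is_SPNE C r K s \<sigma> \<longleftrightarrow> is_profile C K \<sigma> \<and>
     (\<forall>i<agents C. \<forall>\<sigma>'\<in>strategies C K i. \<forall>l<K. \<forall>h\<in>hist_from C s l.
        expected C (indep C \<sigma>) K h (total_reward r i)
          \<ge> expected C (indep C (\<sigma>(i := \<sigma>'))) K h (total_reward r i))"

definition is_SPCE :: "nscsg \<Rightarrow> rewards \<Rightarrow> nat \<Rightarrow> gstate \<Rightarrow> (run \<Rightarrow> joint_act pmf) \<Rightarrow> bool" where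
  "is_SPCE C r K s \<tau> \<longleftrightarrow> is_corr_profile C K \<tau> \<and>
     (\<forall>i<agents C. \<forall>l<K. \<forall>h\<in>hist_from C s l. \<forall>a\<in>acts_at C i (lst h). \<forall>a'\<in>acts_at C i (lst h).
        recommends (\<tau> h) i a \<longrightarrow>
        expected_dev C \<tau> K h (total_reward r i) i a a
          \<ge> expected_dev C \<tau> K h (total_reward r i) i a a')"

definition welfare :: "nscsg \<Rightarrow> rewards \<Rightarrow> nat \<Rightarrow> run \<Rightarrow> (run \<Rightarrow> joint_act pmf) \<Rightarrow> real" where
  "welfare C r K h \<tau> = expected C \<tau> K h (\<lambda>\<pi>. \<Sum>i<agents C. total_reward r i \<pi>)"

definition is_SW_SPNE :: "nscsg \<Rightarrow> rewards \<Rightarrow> nat \<Rightarrow> gstate \<Rightarrow> (nat \<Rightarrow> run \<Rightarrow> act pmf) \<Rightarrow> bool" where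
  "is_SW_SPNE C r K s \<sigma> \<longleftrightarrow> is_SPNE C r K s \<sigma> \<and>
     (\<forall>\<sigma>'. is_SPNE C r K s \<sigma>' \<longrightarrow>
        welfare C r K (s, []) (indep C \<sigma>) \<ge> welfare C r K (s, []) (indep C \<sigma>'))"

definition is_SW_SPCE :: "nscsg \<Rightarrow> rewards \<Rightarrow> nat \<Rightarrow> gstate \<Rightarrow> (run \<Rightarrow> joint_act pmf) \<Rightarrow> bool" where
  "is_SW_SPCE C r K s \<tau> \<longleftrightarrow> is_SPCE C r K s \<tau> \<and>
     (\<forall>\<tau>'. is_SPCE C r K s \<tau>' \<longrightarrow> welfare C r K (s, []) \<tau> \<ge> welfare C r K (s, []) \<tau>')"


section \<open>Normal-form games\<close>

record nfg =
  players :: nat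
  choices :: "nat \<Rightarrow> act set"
  util :: "nat \<Rightarrow> joint_act \<Rightarrow> real"

definition nfg_payoff :: "nfg \<Rightarrow> joint_act pmf \<Rightarrow> nat \<Rightarrow> real" where
  "nfg_payoff G \<kappa> i = measure_pmf.expectation \<kappa> (util G i)"

definition nfg_welfare :: "nfg \<Rightarrow> joint_act pmf \<Rightarrow> real" where
  "nfg_welfare G \<kappa> = (\<Sum>i<players G. nfg_payoff G \<kappa> i)"

definition nfg_indep :: "nfg \<Rightarrow> (nat \<Rightarrow> act pmf) \<Rightarrow> joint_act pmf" where
  "nfg_indep G \<mu> = joint_pmf (players G) \<mu>"

definition is_NE :: "nfg \<Rightarrow> (nat \<Rightarrow> act pmf) \<Rightarrow> bool" where
  "is_NE G \<mu> \<longleftrightarrow>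
     (\<forall>i<players G. set_pmf (\<mu> i) \<subseteq> choices G i) \<and>
     (\<forall>i<players G. \<forall>\<nu>. set_pmf \<nu> \<subseteq> choices G i \<longrightarrow>
        nfg_payoff G (nfg_indep G \<mu>) i \<ge> nfg_payoff G (nfg_indep G (\<mu>(i := \<nu>))) i)"

definition is_CE :: "nfg \<Rightarrow> joint_act pmf \<Rightarrow> bool" where
  "is_CE G \<kappa> \<longleftrightarrow>
     (\<forall>\<alpha>\<in>set_pmf \<kappa>. length \<alpha> = players G \<and> (\<forall>i<players G. \<alpha> ! i \<in> choices G i)) \<and>
     (\<forall>i<players G. \<forall>a\<in>choices G i. \<forall>a'\<in>choices G i.
        recommends \<kappa> i a \<longrightarrow>
        nfg_payoff G (deviate \<kappa> i a a) i \<ge> nfg_payoff G (deviate \<kappa> i a a') i)"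

definition is_SWNE :: "nfg \<Rightarrow> (nat \<Rightarrow> act pmf) \<Rightarrow> bool" where
  "is_SWNE G \<mu> \<longleftrightarrow> is_NE G \<mu> \<and>
     (\<forall>\<mu>'. is_NE G \<mu>' \<longrightarrow> nfg_welfare G (nfg_indep G \<mu>) \<ge> nfg_welfare G (nfg_indep G \<mu>'))"

definition is_SWCE :: "nfg \<Rightarrow> joint_act pmf \<Rightarrow> bool" where
  "is_SWCE G \<kappa> \<longleftrightarrow> is_CE G \<kappa> \<and> (\<forall>\<kappa>'. is_CE G \<kappa>' \<longrightarrow> nfg_welfare G \<kappa> \<ge> nfg_welfare G \<kappa>')"


section \<open>Generalized backward induction\<close>

text \<open>
  A solver may break ties differently at different histories; a solver that sees only the game is
  the special case of a constant first argument. Finite games always have an SWNE and an SWCE, so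
  the existence premises below only cover arguments that are not finite games.
\<close>

definition is_SWNE_solver :: "(run \<Rightarrow> nfg \<Rightarrow> nat \<Rightarrow> act pmf) \<Rightarrow> bool" where
  "is_SWNE_solver sol \<longleftrightarrow> (\<forall>h G. (\<exists>\<mu>. is_SWNE G \<mu>) \<longrightarrow> is_SWNE G (sol h G))"

definition is_SWCE_solver :: "(run \<Rightarrow> nfg \<Rightarrow> joint_act pmf) \<Rightarrow> bool" where
  "is_SWCE_solver sol \<longleftrightarrow> (\<forall>h G. (\<exists>\<kappa>. is_SWCE G \<kappa>) \<longrightarrow> is_SWCE G (sol h G))"

definition succ_via :: "nscsg \<Rightarrow> run \<Rightarrow> joint_act \<Rightarrow> run set" where
  "succ_via C h \<alpha> = {append_step h \<alpha> s' |s'. pmf (next_state C (lst h) \<alpha>) s' > 0}"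

text \<open>The game at \<open>h\<close> induced by continuation payoffs \<open>V\<close>:\<close>

definition induced :: "nscsg \<Rightarrow> rewards \<Rightarrow> (run \<Rightarrow> nat \<Rightarrow> real) \<Rightarrow> run \<Rightarrow> nfg" where
  "induced C r V h =
     \<lparr> players = agents C,
       choices = (\<lambda>i. acts_at C i (lst h)),
       util = (\<lambda>i \<alpha>. act_rew r i (lst h) \<alpha> + state_rew r i (lst h) +
                 (\<Sum>h'\<in>succ_via C h \<alpha>. pmf (next_state C (lst h) \<alpha>) (lst h') * V h' i)) \<rparr>"

text \<open>
  The payoffs \<open>V\<close> at a history with \<open>m\<close> stages to go. The argument \<open>sol\<close> yields the joint
  distribution of the equilibrium selected by the solver. The recursion consults only successors,
  so on the histories from \<open>s\<close> it is backward induction started from \<open>s\<close>; it is defined at the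
  other histories as well because a profile is a function on all histories. The choices made there
  affect neither the incentive conditions nor the welfare for \<open>s\<close>.
\<close>

primrec gbi_values ::
  "(run \<Rightarrow> nfg \<Rightarrow> joint_act pmf) \<Rightarrow> nscsg \<Rightarrow> rewards \<Rightarrow> nat \<Rightarrow> run \<Rightarrow> nat \<Rightarrow> real" where
  "gbi_values sol C r 0 = (\<lambda>h i. state_rew r i (lst h))"
| "gbi_values sol C r (Suc m) = (\<lambda>h.
     let G = induced C r (gbi_values sol C r m) h in nfg_payoff G (sol h G))"

definition gbi_game ::
  "(run \<Rightarrow> nfg \<Rightarrow> joint_act pmf) \<Rightarrow> nscsg \<Rightarrow> rewards \<Rightarrow> nat \<Rightarrow> run \<Rightarrow> nfg" where
  "gbi_game sol C r K h = induced C r (gbi_values sol C r (K - stage h - 1)) h"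

definition GBI_NE ::
  "(run \<Rightarrow> nfg \<Rightarrow> nat \<Rightarrow> act pmf) \<Rightarrow> nscsg \<Rightarrow> rewards \<Rightarrow> nat \<Rightarrow> nat \<Rightarrow> run \<Rightarrow> act pmf" where
  "GBI_NE sol C r K = (\<lambda>i h. sol h (gbi_game (\<lambda>h G. nfg_indep G (sol h G)) C r K h) i)"

definition GBI_CE ::
  "(run \<Rightarrow> nfg \<Rightarrow> joint_act pmf) \<Rightarrow> nscsg \<Rightarrow> rewards \<Rightarrow> nat \<Rightarrow> run \<Rightarrow> joint_act pmf" where
  "GBI_CE sol C r K = (\<lambda>h. sol h (gbi_game sol C r K h))"

end

theory Submission
  imports Defs
begin

text \<open>
  Agent 0 moves first, either to a phase where agent 1, itself indifferent, gives agent 0 a reward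
  of 1 or -1, or to a phase that is worth 0 to agent 0 and \<open>M + 2\<close> to agent 1. Backward
  induction selects the reward 1 in the first phase, because this maximises welfare locally, and so
  agent 0 moves there, with total welfare 1. The threat of the reward -1 is equally credible and
  leads agent 0 to the second phase, with welfare \<open>M + 2\<close>. The game is the same for both types
  of equilibrium: in each induced normal-form game all utilities depend on the action of one agent
  only, and then Nash and correlated equilibria are both characterised by that agent optimising.
\<close>

section \<open>Joint distributions\<close>

lemma set_joint_pmf:
  "set_pmf (joint_pmf n \<mu>) = {xs. length xs = n \<and> (\<forall>i<n. xs ! i \<in> set_pmf (\<mu> i))}"
  by (auto simp: set_pmf_iff pmf_joint_pmf split: if_splits)

lemma map_nth_joint_pmf: "i < n \<Longrightarrow> map_pmf (\<lambda>xs. xs ! i) (joint_pmf n \<mu>) = \<mu> i"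
  using Pi_pmf_component[of "{..<n}" i undefined \<mu>]
  by (simp add: joint_pmf_def pmf.map_comp comp_def)

lemma expectation_nth_joint_pmf:
  fixes f :: "'b \<Rightarrow> real"
  assumes "i < n"
  shows "measure_pmf.expectation (joint_pmf n \<mu>) (\<lambda>xs. f (xs ! i)) = measure_pmf.expectation (\<mu> i) f"
  by (subst map_nth_joint_pmf[OF assms, symmetric]) simp

lemma joint_pmf_return_pmf: "joint_pmf n (\<lambda>i. return_pmf (f i)) = return_pmf (map f [0..<n])"
  by (simp add: joint_pmf_def)

lemma expectation_eq_const:
  fixes f :: "'a \<Rightarrow> real"
  assumes "\<And>x. x \<in> set_pmf p \<Longrightarrow> f x = c"
  shows "measure_pmf.expectation p f = c"
proof -
  have "measure_pmf.expectation p f = measure_pmf.expectation p (\<lambda>_. c)"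
    by (intro integral_cong_AE) (auto simp: AE_measure_pmf_iff assms)
  then show ?thesis by simp
qed

lemma expectation_le_const:
  fixes f :: "'a \<Rightarrow> real"
  assumes "finite (set_pmf p)" "\<And>x. x \<in> set_pmf p \<Longrightarrow> f x \<le> c"
  shows "measure_pmf.expectation p f \<le> c"
  by (intro measure_pmf.integral_le_const integrable_measure_pmf_finite)
     (auto simp: AE_measure_pmf_iff assms)

lemma expectation_bind_finite:
  fixes f :: "'b \<Rightarrow> real"
  assumes "finite (set_pmf p)" "\<And>x. x \<in> set_pmf p \<Longrightarrow> finite (set_pmf (q x))"
  shows "measure_pmf.expectation (bind_pmf p q) f =
    measure_pmf.expectation p (\<lambda>x. measure_pmf.expectation (q x) f)"
  by (subst pmf_expectation_bind[OF assms(1)])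
     (use assms in \<open>auto simp: integral_measure_pmf[OF assms(1)]\<close>)

lemma finite_lists_of_choices:
  assumes "\<And>i. i < n \<Longrightarrow> finite (S i)"
  shows "finite {xs. length xs = n \<and> (\<forall>i<n. xs ! i \<in> S i)}"
proof (rule finite_subset)
  show "{xs. length xs = n \<and> (\<forall>i<n. xs ! i \<in> S i)} \<subseteq> {xs. set xs \<subseteq> (\<Union>i<n. S i) \<and> length xs = n}"
    by (fastforce simp: in_set_conv_nth)
  show "finite {xs. set xs \<subseteq> (\<Union>i<n. S i) \<and> length xs = n}"
    using assms by (intro finite_lists_length_eq) auto
qed

section \<open>Recommendations and conditional deviations\<close>

lemma recommends_iff: "recommends \<rho> i a \<longleftrightarrow> (\<exists>\<alpha>\<in>set_pmf \<rho>. \<alpha> ! i = a)"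
proof
  assume "recommends \<rho> i a"
  then have "measure_pmf.prob \<rho> {\<alpha>. \<alpha> ! i = a} \<noteq> 0" by (simp add: recommends_def)
  then show "\<exists>\<alpha>\<in>set_pmf \<rho>. \<alpha> ! i = a" by (auto simp: measure_pmf_zero_iff)
next
  assume "\<exists>\<alpha>\<in>set_pmf \<rho>. \<alpha> ! i = a"
  then show "recommends \<rho> i a"
    unfolding recommends_def by (auto intro: measure_pmf_posI)
qed

text \<open>The hypothesis makes the conditioning event meet the support of \<open>\<rho>\<close>,
  which is what gives \<open>cond_pmf\<close> its intended meaning.\<close>

lemma set_pmf_deviate:
  assumes "recommends \<rho> i a"
  shows "set_pmf (deviate \<rho> i a a') = (\<lambda>\<alpha>. \<alpha>[i := a']) ` {\<alpha>\<in>set_pmf \<rho>. \<alpha> ! i = a}"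
proof -
  have "set_pmf \<rho> \<inter> {\<alpha>. \<alpha> ! i = a} \<noteq> {}" using assms by (auto simp: recommends_iff)
  then show ?thesis by (auto simp: deviate_def set_cond_pmf)
qed

text \<open>Disobedience changes coordinate \<open>i\<close> only, under an unchanged conditioning
  event. Hence an agent whose reward is decided by somebody else cannot gain from it.\<close>

lemma expectation_deviate_other:
  fixes f :: "act \<Rightarrow> real"
  assumes "i \<noteq> j"
  shows "measure_pmf.expectation (deviate \<rho> i a a') (\<lambda>\<alpha>. f (\<alpha> ! j)) =
    measure_pmf.expectation (deviate \<rho> i a a) (\<lambda>\<alpha>. f (\<alpha> ! j))"
  using assms by (simp add: deviate_def)


section \<open>Normal-form games with a single controller\<close>

definition argmax_on :: "'a set \<Rightarrow> ('a \<Rightarrow> real) \<Rightarrow> 'a set" where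
  "argmax_on S f = {a\<in>S. \<forall>b\<in>S. f b \<le> f a}"

lemma argmax_on_nonempty:
  assumes "finite S" "S \<noteq> {}"
  shows "argmax_on S f \<noteq> {}"
proof -
  have "Max (f ` S) \<in> f ` S" using assms by (intro Max_in) auto
  then obtain a where "a \<in> S" "Max (f ` S) = f a" by auto
  then have "a \<in> argmax_on S f" using Max_ge[of "f ` S"] assms by (auto simp: argmax_on_def)
  then show ?thesis by auto
qed

definition outcomes :: "nfg \<Rightarrow> joint_act set" where
  "outcomes G = {\<alpha>. length \<alpha> = players G \<and> (\<forall>i<players G. \<alpha> ! i \<in> choices G i)}"

text \<open>Agent \<open>c\<close> is the controller, and \<open>g i\<close> is the utility of agent
  \<open>i\<close> as a function of the controller's action. The equation is required at all lists,
  not only at outcomes, so that payoffs can be rewritten under any distribution.\<close>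

definition controlled :: "nfg \<Rightarrow> nat \<Rightarrow> (nat \<Rightarrow> act \<Rightarrow> real) \<Rightarrow> bool" where
  "controlled G c g \<longleftrightarrow> c < players G \<and>
     (\<forall>i<players G. finite (choices G i) \<and> choices G i \<noteq> {}) \<and>
     (\<forall>i<players G. \<forall>\<alpha>. util G i \<alpha> = g i (\<alpha> ! c))"

definition rational :: "nfg \<Rightarrow> nat \<Rightarrow> (nat \<Rightarrow> act \<Rightarrow> real) \<Rightarrow> joint_act pmf \<Rightarrow> bool" where
  "rational G c g \<kappa> \<longleftrightarrow> set_pmf \<kappa> \<subseteq> {\<alpha>\<in>outcomes G. \<alpha> ! c \<in> argmax_on (choices G c) (g c)}"

text \<open>The comparison runs over all rational joint distributions, correlated ones included, so
  that one notion serves both equilibrium types.\<close>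

definition optimal :: "nfg \<Rightarrow> nat \<Rightarrow> (nat \<Rightarrow> act \<Rightarrow> real) \<Rightarrow> joint_act pmf \<Rightarrow> bool" where
  "optimal G c g \<kappa> \<longleftrightarrow> rational G c g \<kappa> \<and>
     (\<forall>\<kappa>'. rational G c g \<kappa>' \<longrightarrow> nfg_welfare G \<kappa>' \<le> nfg_welfare G \<kappa>)"

context
  fixes G c g
  assumes ctl: "controlled G c g"
begin

lemma controller_less: "c < players G"
  using ctl by (simp add: controlled_def)

lemma finite_choices: "i < players G \<Longrightarrow> finite (choices G i)"
  and choices_nonempty: "i < players G \<Longrightarrow> choices G i \<noteq> {}"
  using ctl by (auto simp: controlled_def)

lemma nfg_payoff_controlled:
  "i < players G \<Longrightarrow> nfg_payoff G \<kappa> i = measure_pmf.expectation \<kappa> (\<lambda>\<alpha>. g i (\<alpha> ! c))"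
proof -
  assume "i < players G"
  then have "util G i = (\<lambda>\<alpha>. g i (\<alpha> ! c))" using ctl by (auto simp: controlled_def)
  then show ?thesis by (simp add: nfg_payoff_def)
qed

lemma finite_rational: "rational G c g \<kappa> \<Longrightarrow> finite (set_pmf \<kappa>)"
  using finite_lists_of_choices[of "players G" "choices G"] finite_choices
  by (auto simp: rational_def outcomes_def elim!: finite_subset[rotated])

text \<open>A controller that plays \<open>b\<close> gets exactly \<open>g c b\<close>, whatever the
  others are told, so obedience means that every recommended action is a maximiser. All other agents
  are indifferent.\<close>

lemma is_CE_iff_rational: "is_CE G \<kappa> \<longleftrightarrow> rational G c g \<kappa>"
proof
  assume CE: "is_CE G \<kappa>"
  have out: "set_pmf \<kappa> \<subseteq> outcomes G" using CE by (auto simp: is_CE_def outcomes_def)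
  moreover have "\<alpha> ! c \<in> argmax_on (choices G c) (g c)" if \<alpha>: "\<alpha> \<in> set_pmf \<kappa>" for \<alpha>
  proof -
    have mem: "\<alpha> ! c \<in> choices G c" using out \<alpha> controller_less by (auto simp: outcomes_def)
    have rec: "recommends \<kappa> c (\<alpha> ! c)" using \<alpha> by (auto simp: recommends_iff)
    have val: "nfg_payoff G (deviate \<kappa> c (\<alpha> ! c) a) c = g c a" for a
      using out controller_less
      by (subst nfg_payoff_controlled)
         (auto intro!: expectation_eq_const simp: set_pmf_deviate[OF rec] outcomes_def subset_eq)
    have "g c b \<le> g c (\<alpha> ! c)" if "b \<in> choices G c" for b
      using CE rec mem controller_less that unfolding is_CE_def by (metis val)
    then show ?thesis using mem by (simp add: argmax_on_def)
  qed
  ultimately show "rational G c g \<kappa>" by (auto simp: rational_def)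
next
  assume R: "rational G c g \<kappa>"
  have "nfg_payoff G (deviate \<kappa> i a a') i \<le> nfg_payoff G (deviate \<kappa> i a a) i"
    if i: "i < players G" and a: "a' \<in> choices G i" and rec: "recommends \<kappa> i a" for i a a'
  proof (cases "i = c")
    case True
    have val: "nfg_payoff G (deviate \<kappa> c a b) c = g c b" for b
      using R controller_less rec True
      by (subst nfg_payoff_controlled)
         (auto intro!: expectation_eq_const simp: set_pmf_deviate rational_def outcomes_def subset_eq)
    have "a \<in> argmax_on (choices G c) (g c)"
      using rec R True by (auto simp: recommends_iff rational_def)
    then show ?thesis using a True by (auto simp: val argmax_on_def)
  next
    case False
    then show ?thesis using expectation_deviate_other[of i c \<kappa> a a' "g i"] i
      by (simp add: nfg_payoff_controlled)
  qed
  then show "is_CE G \<kappa>" using R by (auto simp: is_CE_def rational_def outcomes_def)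
qed

text \<open>Payoffs depend on the marginal \<open>\<mu> c\<close> alone, so the only incentive
  condition is that this marginal be supported on maximisers.\<close>

lemma is_NE_iff_rational: "is_NE G \<mu> \<longleftrightarrow> rational G c g (nfg_indep G \<mu>)"
proof -
  have val: "nfg_payoff G (nfg_indep G \<nu>) i = measure_pmf.expectation (\<nu> c) (g i)"
    if "i < players G" for i \<nu>
    using that controller_less by (simp add: nfg_payoff_controlled nfg_indep_def expectation_nth_joint_pmf)
  have proj: "set_pmf (\<mu> i) = (\<lambda>\<alpha>. \<alpha> ! i) ` set_pmf (nfg_indep G \<mu>)" if "i < players G" for i
    using arg_cong[OF map_nth_joint_pmf[OF that, of \<mu>], of set_pmf] by (simp add: nfg_indep_def)
  have "is_NE G \<mu> \<longleftrightarrow> (\<forall>i<players G. set_pmf (\<mu> i) \<subseteq> choices G i) \<and>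
    set_pmf (\<mu> c) \<subseteq> argmax_on (choices G c) (g c)" (is "_ \<longleftrightarrow> ?S \<and> ?A")
  proof (intro iffI conjI)
    assume NE: "is_NE G \<mu>"
    then show S: ?S by (simp add: is_NE_def)
    have fin: "finite (set_pmf (\<mu> c))"
      using S controller_less finite_choices finite_subset by blast
    have le: "g c b \<le> measure_pmf.expectation (\<mu> c) (g c)" if "b \<in> choices G c" for b
    proof -
      have "set_pmf (return_pmf b) \<subseteq> choices G c" using that by simp
      then have "nfg_payoff G (nfg_indep G (\<mu>(c := return_pmf b))) c \<le> nfg_payoff G (nfg_indep G \<mu>) c"
        using NE controller_less unfolding is_NE_def by blast
      then show ?thesis using controller_less by (simp add: val)
    qed
    \<comment> \<open>Pure deviations show that no available action beats the mean. The difference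
      between the mean and \<open>g c\<close> is thus non-negative with integral 0, and vanishes on
      the support.\<close>
    have eq: "g c a = measure_pmf.expectation (\<mu> c) (g c)" if a: "a \<in> set_pmf (\<mu> c)" for a
    proof -
      let ?e = "measure_pmf.expectation (\<mu> c) (g c)"
      have int: "integrable (\<mu> c) (\<lambda>x. ?e - g c x)"
        by (intro integrable_measure_pmf_finite fin)
      have ge: "AE x in \<mu> c. 0 \<le> ?e - g c x"
        using le S controller_less by (auto simp: AE_measure_pmf_iff subset_eq)
      have "measure_pmf.expectation (\<mu> c) (\<lambda>x. ?e - g c x) = 0"
        using fin by (subst Bochner_Integration.integral_diff) (auto intro: integrable_measure_pmf_finite)
      then have "AE x in \<mu> c. ?e - g c x = 0"
        using integral_nonneg_eq_0_iff_AE[OF int ge] by simp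
      then show ?thesis using a by (simp add: AE_measure_pmf_iff)
    qed
    show ?A using eq le S controller_less by (auto simp: argmax_on_def subset_eq)
  next
    assume A: "?S \<and> ?A"
    have "nfg_payoff G (nfg_indep G (\<mu>(i := \<nu>))) i \<le> nfg_payoff G (nfg_indep G \<mu>) i"
      if i: "i < players G" and \<nu>: "set_pmf \<nu> \<subseteq> choices G i" for i \<nu>
    proof (cases "i = c")
      case True
      obtain a where a: "a \<in> set_pmf (\<mu> c)" using set_pmf_not_empty[of "\<mu> c"] by blast
      have "measure_pmf.expectation (\<mu> c) (g c) = g c a"
      proof (rule expectation_eq_const)
        fix x assume "x \<in> set_pmf (\<mu> c)"
        then have "x \<in> argmax_on (choices G c) (g c)" "a \<in> argmax_on (choices G c) (g c)"
          using A a by auto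
        then show "g c x = g c a" unfolding argmax_on_def by (auto intro: antisym)
      qed
      moreover have "measure_pmf.expectation \<nu> (g c) \<le> g c a"
        using A a \<nu> True finite_choices[OF controller_less]
        by (intro expectation_le_const) (auto simp: argmax_on_def subset_eq intro: finite_subset)
      ultimately show ?thesis using True controller_less by (simp add: val)
    qed (use i in \<open>simp add: val\<close>)
    then show "is_NE G \<mu>" using A by (auto simp: is_NE_def)
  qed
  also have "\<dots> \<longleftrightarrow> rational G c g (nfg_indep G \<mu>)"
  proof -
    have "\<And>\<alpha>. \<alpha> \<in> set_pmf (nfg_indep G \<mu>) \<Longrightarrow> length \<alpha> = players G"
      by (simp add: nfg_indep_def set_joint_pmf)
    then show ?thesis using controller_less by (auto simp: rational_def outcomes_def proj)
  qed
  finally show ?thesis .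
qed

lemma nfg_welfare_controlled:
  assumes "rational G c g \<kappa>"
  shows "nfg_welfare G \<kappa> = measure_pmf.expectation \<kappa> (\<lambda>\<alpha>. \<Sum>i<players G. g i (\<alpha> ! c))"
  using finite_rational[OF assms]
  by (subst Bochner_Integration.integral_sum)
     (auto simp: nfg_welfare_def nfg_payoff_controlled intro: integrable_measure_pmf_finite)

text \<open>Welfare depends on the controller's action only, so averaging over maximisers cannot
  beat the maximiser with the best welfare. A point mass is also a product, so it provides the
  existence premise of both solver notions.\<close>

lemma pure_optimal: "\<exists>\<alpha>. length \<alpha> = players G \<and> optimal G c g (return_pmf \<alpha>)"
proof -
  define B where "B = argmax_on (choices G c) (g c)"
  have sub: "B \<subseteq> choices G c" by (auto simp: B_def argmax_on_def)
  have B: "finite B" "B \<noteq> {}"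
    using finite_subset[OF sub] finite_choices[OF controller_less]
      argmax_on_nonempty[OF finite_choices choices_nonempty, OF controller_less controller_less]
    by (simp_all add: B_def)
  define W where "W = (\<lambda>a. \<Sum>i<players G. g i a)"
  obtain a where a: "a \<in> argmax_on B W" using argmax_on_nonempty[OF B] by blast
  \<comment> \<open>The other coordinates affect no utility, so any available action will
    do.\<close>
  define \<alpha> where "\<alpha> = map (\<lambda>i. if i = c then a else SOME x. x \<in> choices G i) [0..<players G]"
  have \<alpha>c: "\<alpha> ! c = a" using controller_less by (simp add: \<alpha>_def)
  have R: "rational G c g (return_pmf \<alpha>)"
    using a sub choices_nonempty \<alpha>c
    by (auto simp: rational_def outcomes_def \<alpha>_def some_in_eq argmax_on_def B_def)
  have "nfg_welfare G \<kappa>' \<le> nfg_welfare G (return_pmf \<alpha>)" if "rational G c g \<kappa>'" for \<kappa>'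
    using that a \<alpha>c
    by (auto simp: nfg_welfare_controlled[OF that] nfg_welfare_controlled[OF R] rational_def
        argmax_on_def B_def W_def subset_eq intro!: expectation_le_const finite_rational)
  moreover have "length \<alpha> = players G" by (simp add: \<alpha>_def)
  ultimately show ?thesis using R by (auto simp: optimal_def)
qed

section \<open>Behaviour of the solvers on controlled games\<close>

lemma SWCE_solver_optimal:
  assumes "is_SWCE_solver sol"
  shows "optimal G c g (sol h G)"
proof -
  obtain \<alpha> where "optimal G c g (return_pmf \<alpha>)" using pure_optimal by blast
  then have "is_SWCE G (return_pmf \<alpha>)" by (simp add: is_SWCE_def is_CE_iff_rational optimal_def)
  then have "is_SWCE G (sol h G)" using assms unfolding is_SWCE_solver_def by blast
  then show ?thesis by (simp add: is_SWCE_def is_CE_iff_rational optimal_def)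
qed

text \<open>By definition an SWNE competes only with product distributions. Since the pure optimum
  is itself a product, it also wins against the correlated ones.\<close>

lemma SWNE_solver_optimal:
  assumes "is_SWNE_solver sol"
  shows "optimal G c g (nfg_indep G (sol h G))" "is_NE G (sol h G)"
proof -
  obtain \<alpha> where \<alpha>: "length \<alpha> = players G" "optimal G c g (return_pmf \<alpha>)"
    using pure_optimal by blast
  have pure: "nfg_indep G (\<lambda>i. return_pmf (\<alpha> ! i)) = return_pmf \<alpha>"
    using \<alpha>(1) by (simp add: nfg_indep_def joint_pmf_return_pmf flip: \<alpha>(1)) (simp add: map_nth)
  have NE: "is_SWNE G (\<lambda>i. return_pmf (\<alpha> ! i))"
    using \<alpha>(2) by (simp add: is_SWNE_def is_NE_iff_rational optimal_def pure)
  then have S: "is_SWNE G (sol h G)" using assms unfolding is_SWNE_solver_def by blast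
  then show "is_NE G (sol h G)" by (simp add: is_SWNE_def)
  have "nfg_welfare G (return_pmf \<alpha>) \<le> nfg_welfare G (nfg_indep G (sol h G))"
    using S NE pure by (metis is_SWNE_def)
  then show "optimal G c g (nfg_indep G (sol h G))"
    using S \<alpha>(2) by (force simp: is_SWNE_def is_NE_iff_rational optimal_def)
qed

end

section \<open>The punishment game\<close>

text \<open>
  The value \<open>x\<close> of the environment is the phase of the game. In phase 0 agent 0 chooses between
  phases 1 and 2; in phase 1 agent 1, who gets nothing there, decides about the reward of agent 0;
  in phase 2 agent 1 receives \<open>M + 2\<close>. There is a single local state, a point of dimension 0.
\<close>

definition phase :: "real \<Rightarrow> gstate" where
  "phase x = ([([], []), ([], [])], [x])"

text \<open>Phases 1 and 2 are absorbing. In phase 0 every action other than \<open>Some 1\<close>,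
  including the idle one, leads to phase 2, which keeps the environment closed under all joint
  actions.\<close>

definition move :: "real \<Rightarrow> act \<Rightarrow> real" where
  "move x a = (if x = 0 then if a = Some 1 then 1 else 2 else x)"

text \<open>The two rewards of agent 0 in phase 1 lie on either side of the 0 it gets in phase 2, so
  the reply of agent 1 decides where agent 0 wants to go. The value \<open>M + 2\<close> exceeds the
  best welfare 1 of phase 1 by \<open>M + 1\<close>.\<close>

definition pay :: "real \<Rightarrow> nat \<Rightarrow> real \<Rightarrow> act \<Rightarrow> real" where
  "pay M i x b =
     (if x = 1 \<and> i = 0 then if b = Some 1 then 1 else -1 else if x = 2 \<and> i = 1 then M + 2 else 0)"

lemma pay_0: "pay M 0 x b = (if x = 1 then if b = Some 1 then 1 else -1 else 0)"
  and pay_1: "pay M 1 x b = (if x = 2 then M + 2 else 0)"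
  by (auto simp: pay_def)

definition punishment_game :: nscsg where
  "punishment_game =
     \<lparr> agents = 2, loc_dim = (\<lambda>_. 0), per_dim = (\<lambda>_. 0), env_dim = 1,
       Loc = (\<lambda>_. {[]}), Per = (\<lambda>_. {[]}), Env = {[0], [1], [2]},
       Act = (\<lambda>_. {0, 1}), avail = (\<lambda>_ _. {0, 1}), obs = (\<lambda>_ _. []),
       loc_trans = (\<lambda>_ _ _. return_pmf []), env_trans = (\<lambda>e \<alpha>. [move (hd e) (\<alpha> ! 0)]) \<rparr>"

definition punishment_rewards :: "real \<Rightarrow> rewards" where
  "punishment_rewards M =
     \<lparr> act_rew = (\<lambda>i s \<alpha>. pay M i (hd (snd s)) (\<alpha> ! 1)), state_rew = (\<lambda>_ _. 0) \<rparr>"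

lemma agents_punishment_game [simp]: "agents punishment_game = 2"
  by (simp add: punishment_game_def)

lemma phase_simps [simp]: "snd (phase x) = [x]" "phase x = phase y \<longleftrightarrow> x = y"
  by (auto simp: phase_def)

lemma less_two_iff: "i < (2::nat) \<longleftrightarrow> i = 0 \<or> i = 1"
  by auto

lemma gstates_punishment_game: "gstates punishment_game = phase ` {0, 1, 2}"
  by (auto simp: gstates_def punishment_game_def phase_def length_Suc_conv
      numeral_2_eq_2 less_Suc_eq all_conj_distrib)

lemma is_nscsg_punishment_game: "is_nscsg punishment_game"
  by (auto simp: is_nscsg_def gstates_punishment_game) (auto simp: punishment_game_def move_def)

lemma acts_at_punishment_game [simp]: "acts_at punishment_game i s = {Some 0, Some 1}"
  by (simp add: acts_at_def punishment_game_def)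

definition moves :: "joint_act set" where
  "moves = {\<alpha>. length \<alpha> = 2 \<and> (\<forall>i<2. \<alpha> ! i \<in> {Some 0, Some 1})}"

lemma joint_acts_at_punishment_game [simp]: "joint_acts_at punishment_game s = moves"
  by (simp add: joint_acts_at_def moves_def)

lemma finite_moves: "finite moves"
  unfolding moves_def by (rule finite_lists_of_choices) auto

section \<open>Transitions and histories of the punishment game\<close>

lemma next_state_phase:
  "next_state punishment_game (phase x) \<alpha> = return_pmf (phase (move x (\<alpha> ! 0)))"
  by (simp add: next_state_def punishment_game_def joint_pmf_return_pmf phase_def numeral_2_eq_2)

lemma hist_lst:
  assumes "h \<in> hist punishment_game l"
  obtains x where "lst h = phase x" "stage h = l"
proof -
  from assms have "stage h = l" "lst h \<in> gstates punishment_game" by (auto simp: hist_def lst_def)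
  then show ?thesis using that by (auto simp: gstates_punishment_game)
qed

abbreviation start :: run where
  "start \<equiv> (phase 0, [])"

abbreviation after :: "joint_act \<Rightarrow> run" where
  "after \<alpha> \<equiv> (phase 0, [(\<alpha>, phase (move 0 (\<alpha> ! 0)))])"

lemma run_simps [simp]:
  "lst (s, []) = s" "stage (s, []) = 0"
  "lst (s, [(\<alpha>, s')]) = s'" "stage (s, [(\<alpha>, s')]) = 1"
  by (auto simp: lst_def stage_def st_def)

lemma hist_from_0: "hist_from punishment_game (phase 0) 0 = {start}"
  by (auto simp: hist_from_def hist_def st_def stage_def gstates_punishment_game)

text \<open>Transitions are deterministic, so a history of stage 1 from phase 0 is determined by its
  joint action.\<close>

lemma hist_from_1: "hist_from punishment_game (phase 0) 1 = after ` moves"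
proof (intro equalityI subsetI)
  fix h assume "h \<in> hist_from punishment_game (phase 0) 1"
  then have h: "length (snd h) = 1" "fst h = phase 0" "ac h 0 \<in> moves"
    "pmf (next_state punishment_game (phase 0) (ac h 0)) (st h 1) > 0"
    by (auto simp: hist_from_def hist_def stage_def st_def)
  obtain \<alpha> s' where "h = (phase 0, [(\<alpha>, s')])"
    using h(1,2) by (cases h) (auto simp: length_Suc_conv)
  moreover from this have "\<alpha> \<in> moves" "s' = phase (move 0 (\<alpha> ! 0))"
    using h(3,4) by (auto simp: ac_def st_def next_state_phase indicator_def simp del: split_paired_Ex
        split: if_splits)
  ultimately show "h \<in> after ` moves" by blast
qed (auto simp: hist_from_def hist_def stage_def st_def ac_def next_state_phase
      gstates_punishment_game le_Suc_eq move_def split: if_splits)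

lemma start_hist: "start \<in> hist punishment_game 0"
  using hist_from_0 by (auto simp: hist_from_def)

lemma after_hist: "\<alpha> \<in> moves \<Longrightarrow> after \<alpha> \<in> hist punishment_game 1"
  using hist_from_1 by (auto simp: hist_from_def)

lemma corr_profile_moves:
  assumes "is_corr_profile punishment_game 2 \<tau>"
  shows "set_pmf (\<tau> start) \<subseteq> moves" "\<alpha> \<in> moves \<Longrightarrow> set_pmf (\<tau> (after \<alpha>)) \<subseteq> moves"
proof -
  have *: "set_pmf (\<tau> h) \<subseteq> moves" if "h \<in> hist punishment_game l" "l < 2" for h l
    using assms that by (auto simp: is_corr_profile_def)
  show "set_pmf (\<tau> start) \<subseteq> moves" using *[OF start_hist] by simp
  show "set_pmf (\<tau> (after \<alpha>)) \<subseteq> moves" if "\<alpha> \<in> moves" using *[OF after_hist[OF that]] by simp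
qed

lemma indep_corr_profile:
  assumes "is_profile punishment_game 2 \<sigma>"
  shows "is_corr_profile punishment_game 2 (indep punishment_game \<sigma>)"
proof -
  have "set_pmf (\<sigma> i h) \<subseteq> {Some 0, Some 1}"
    if "h \<in> hist punishment_game l" "l < 2" "i < 2" for i h l
    using assms that unfolding is_profile_def strategies_def by simp
  then have "set_pmf (indep punishment_game \<sigma> h) \<subseteq> moves"
    if "h \<in> hist punishment_game l" "l < 2" for h l
    using that unfolding indep_def set_joint_pmf moves_def agents_punishment_game by blast
  then show ?thesis by (simp add: is_corr_profile_def)
qed


subsection \<open>Expected rewards\<close>

text \<open>As phase 0 pays nothing, this is the whole expected reward of agent \<open>i\<close>
  from \<open>start\<close> once \<open>\<alpha>\<close> has been played.\<close>

definition reply_value :: "real \<Rightarrow> (run \<Rightarrow> joint_act pmf) \<Rightarrow> nat \<Rightarrow> joint_act \<Rightarrow> real" where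
  "reply_value M \<tau> i \<alpha> =
     measure_pmf.expectation (\<tau> (after \<alpha>)) (\<lambda>\<beta>. pay M i (move 0 (\<alpha> ! 0)) (\<beta> ! 1))"

lemma total_reward_after:
  "total_reward (punishment_rewards M) i (phase x, [(\<beta>, s')]) = pay M i x (\<beta> ! 1)"
  by (simp add: total_reward_def punishment_rewards_def st_def ac_def)

lemma total_reward_path:
  "total_reward (punishment_rewards M) i (phase 0, [(\<alpha>, phase x), (\<beta>, s')]) = pay M i x (\<beta> ! 1)"
  by (simp add: total_reward_def punishment_rewards_def st_def ac_def stage_def pay_def)

lemma play_last:
  assumes "lst h = phase x"
  shows "play punishment_game \<rho> (paths punishment_game \<tau> 0) h =
    map_pmf (\<lambda>\<beta>. (phase x, [(\<beta>, phase (move x (\<beta> ! 0)))])) \<rho>"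
  by (simp add: play_def assms next_state_phase bind_return_pmf map_pmf_def append_step_def
      prefix_step_def)
     (simp add: lst_def st_def stage_def)

lemma expected_last:
  assumes "lst h = phase x" "stage h = 1"
  shows "expected punishment_game \<tau> 2 h (total_reward (punishment_rewards M) i) =
    measure_pmf.expectation (\<tau> h) (\<lambda>\<beta>. pay M i x (\<beta> ! 1))"
  using assms(2)
  by (simp add: expected_def play_last[OF assms(1), simplified] total_reward_after)

lemma expected_dev_last:
  assumes "lst h = phase x" "stage h = 1"
  shows "expected_dev punishment_game \<tau> 2 h (total_reward (punishment_rewards M) i) i a a' =
    measure_pmf.expectation (deviate (\<tau> h) i a a') (\<lambda>\<beta>. pay M i x (\<beta> ! 1))"
  using assms(2)
  by (simp add: expected_dev_def play_last[OF assms(1), simplified] total_reward_after)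

text \<open>With \<open>\<rho>\<close> and \<open>Y\<close> left general, one computation covers
  obedience and deviation at the first stage, and both individual rewards and welfare. Finite
  supports justify iterating the expectations.\<close>

lemma expectation_play_first:
  fixes Y :: "run \<Rightarrow> real"
  assumes \<tau>: "is_corr_profile punishment_game 2 \<tau>" and \<rho>: "set_pmf \<rho> \<subseteq> moves"
    and Y: "\<And>\<alpha> x \<beta> s'. Y (phase 0, [(\<alpha>, phase x), (\<beta>, s')]) = f x (\<beta> ! 1)"
  shows "measure_pmf.expectation (play punishment_game \<rho> (paths punishment_game \<tau> 1) start) Y =
    measure_pmf.expectation \<rho> (\<lambda>\<alpha>. measure_pmf.expectation (\<tau> (after \<alpha>)) (\<lambda>\<beta>. f (move 0 (\<alpha> ! 0)) (\<beta> ! 1)))"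
proof -
  have "play punishment_game \<rho> (paths punishment_game \<tau> 1) start =
    bind_pmf \<rho> (\<lambda>\<alpha>. map_pmf (\<lambda>\<beta>. (phase 0, [(\<alpha>, phase (move 0 (\<alpha> ! 0))),
      (\<beta>, phase (move (move 0 (\<alpha> ! 0)) (\<beta> ! 0)))])) (\<tau> (after \<alpha>)))"
    by (subst play_def)
       (simp add: next_state_phase bind_return_pmf append_step_def prefix_step_def
        play_last[simplified] pmf.map_comp comp_def)
  moreover have "finite (set_pmf \<rho>)" "\<And>\<alpha>. \<alpha> \<in> set_pmf \<rho> \<Longrightarrow> finite (set_pmf (\<tau> (after \<alpha>)))"
    using corr_profile_moves[OF \<tau>] \<rho> finite_moves by (meson finite_subset subsetD)+
  ultimately show ?thesis by (simp add: expectation_bind_finite Y)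
qed

lemma expected_first:
  assumes "is_corr_profile punishment_game 2 \<tau>"
  shows "expected punishment_game \<tau> 2 start (total_reward (punishment_rewards M) i) =
    measure_pmf.expectation (\<tau> start) (reply_value M \<tau> i)"
proof -
  have "paths punishment_game \<tau> 2 start =
      play punishment_game (\<tau> start) (paths punishment_game \<tau> 1) start"
    by (simp add: numeral_2_eq_2)
  then show ?thesis
    using expectation_play_first[OF assms corr_profile_moves(1)[OF assms],
        of "total_reward (punishment_rewards M) i" "pay M i"]
    by (simp add: expected_def reply_value_def[abs_def] total_reward_path)
qed

lemma expected_dev_first:
  assumes "is_corr_profile punishment_game 2 \<tau>" and "set_pmf (deviate (\<tau> start) i a a') \<subseteq> moves"
  shows "expected_dev punishment_game \<tau> 2 start (total_reward (punishment_rewards M) i) i a a' =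
    measure_pmf.expectation (deviate (\<tau> start) i a a') (reply_value M \<tau> i)"
  using expectation_play_first[OF assms, of "total_reward (punishment_rewards M) i" "pay M i"]
  by (simp add: expected_dev_def reply_value_def[abs_def] total_reward_path)

lemma welfare_start:
  assumes "is_corr_profile punishment_game 2 \<tau>"
  shows "welfare punishment_game (punishment_rewards M) 2 start \<tau> =
    measure_pmf.expectation (\<tau> start) (\<lambda>\<alpha>. reply_value M \<tau> 0 \<alpha> + reply_value M \<tau> 1 \<alpha>)"
proof -
  have "paths punishment_game \<tau> 2 start =
      play punishment_game (\<tau> start) (paths punishment_game \<tau> 1) start"
    by (simp add: numeral_2_eq_2)
  moreover have "(\<Sum>i<2. total_reward (punishment_rewards M) i (phase 0, [(\<alpha>, phase x), (\<beta>, s')])) =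
      pay M 0 x (\<beta> ! 1) + pay M 1 x (\<beta> ! 1)" for \<alpha> x \<beta> s'
    by (simp add: total_reward_path numeral_2_eq_2)
  ultimately have "welfare punishment_game (punishment_rewards M) 2 start \<tau> =
    measure_pmf.expectation (\<tau> start) (\<lambda>\<alpha>. measure_pmf.expectation (\<tau> (after \<alpha>))
      (\<lambda>\<beta>. pay M 0 (move 0 (\<alpha> ! 0)) (\<beta> ! 1) + pay M 1 (move 0 (\<alpha> ! 0)) (\<beta> ! 1)))"
    using expectation_play_first[OF assms corr_profile_moves(1)[OF assms],
        of "\<lambda>\<pi>. \<Sum>i<2. total_reward (punishment_rewards M) i \<pi>"
           "\<lambda>x b. pay M 0 x b + pay M 1 x b"]
    by (simp add: welfare_def expected_def)
  also have "\<dots> = measure_pmf.expectation (\<tau> start) (\<lambda>\<alpha>. reply_value M \<tau> 0 \<alpha> + reply_value M \<tau> 1 \<alpha>)"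
  proof (intro integral_cong_AE)
    have "integrable (\<tau> (after \<alpha>)) f" if "\<alpha> \<in> set_pmf (\<tau> start)" for \<alpha> and f :: "joint_act \<Rightarrow> real"
      using corr_profile_moves[OF assms] that finite_moves
      by (meson finite_subset subsetD integrable_measure_pmf_finite)
    then show "AE \<alpha> in \<tau> start. measure_pmf.expectation (\<tau> (after \<alpha>))
        (\<lambda>\<beta>. pay M 0 (move 0 (\<alpha> ! 0)) (\<beta> ! 1) + pay M 1 (move 0 (\<alpha> ! 0)) (\<beta> ! 1)) =
        reply_value M \<tau> 0 \<alpha> + reply_value M \<tau> 1 \<alpha>"
      by (auto simp: AE_measure_pmf_iff reply_value_def Bochner_Integration.integral_add)
  qed auto
  finally show ?thesis .
qed

lemma reply_value_1: "reply_value M \<tau> 1 \<alpha> = (if move 0 (\<alpha> ! 0) = 2 then M + 2 else 0)"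
  by (auto simp: reply_value_def pay_def)

text \<open>Phase 1 yields welfare at most 1 and phase 2 exactly \<open>M + 2\<close>. The bound
  holds for every correlated profile, so any equilibrium attaining it is welfare optimal.\<close>

lemma welfare_start_le:
  assumes \<tau>: "is_corr_profile punishment_game 2 \<tau>" and "M > 0"
  shows "welfare punishment_game (punishment_rewards M) 2 start \<tau> \<le> M + 2"
  unfolding welfare_start[OF \<tau>]
proof (rule expectation_le_const)
  show "finite (set_pmf (\<tau> start))"
    using corr_profile_moves[OF \<tau>] finite_moves finite_subset by blast
  fix \<alpha> assume \<alpha>: "\<alpha> \<in> set_pmf (\<tau> start)"
  then have "finite (set_pmf (\<tau> (after \<alpha>)))"
    using corr_profile_moves[OF \<tau>] finite_moves by (meson finite_subset subsetD)
  then have "reply_value M \<tau> 0 \<alpha> \<le> (if move 0 (\<alpha> ! 0) = 1 then 1 else 0)"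
    unfolding reply_value_def by (rule expectation_le_const) (auto simp: pay_def)
  then show "reply_value M \<tau> 0 \<alpha> + reply_value M \<tau> 1 \<alpha> \<le> M + 2"
    unfolding reply_value_1 using \<open>M > 0\<close> by (auto split: if_splits)
qed


subsection \<open>Enforceable first moves\<close>

text \<open>
  Agent 0 is willing to play \<open>a\<close> in phase 0 because the announced replies of agent 1 give no more
  than \<open>v\<close> after any other action. No further incentive condition matters: agent 1 is indifferent
  everywhere, and agent 0 has no influence on the last stage. The rewards of agent 0 do not depend
  on \<open>M\<close>, which is set to 0.
\<close>

definition enforces :: "(run \<Rightarrow> joint_act pmf) \<Rightarrow> act \<Rightarrow> real \<Rightarrow> bool" where
  "enforces \<tau> a v \<longleftrightarrow> is_corr_profile punishment_game 2 \<tau> \<and> (\<forall>\<alpha>\<in>set_pmf (\<tau> start). \<alpha> ! 0 = a) \<and>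
     (\<forall>\<alpha>\<in>moves. reply_value 0 \<tau> 0 \<alpha> \<le> v \<and> (\<alpha> ! 0 = a \<longrightarrow> reply_value 0 \<tau> 0 \<alpha> = v))"

lemma reply_value_0: "reply_value M \<tau> 0 = reply_value 0 \<tau> 0"
  by (simp add: reply_value_def[abs_def] pay_0)

text \<open>The first action of agent 0 is certain, hence so is the phase of the last stage: agent 0
  gets \<open>v\<close>, and agent 1 gets \<open>M + 2\<close> exactly in phase 2.\<close>

lemma welfare_enforces:
  assumes "enforces \<tau> a v"
  shows "welfare punishment_game (punishment_rewards M) 2 start \<tau> =
    v + (if a = Some 1 then 0 else M + 2)"
proof -
  have \<tau>: "is_corr_profile punishment_game 2 \<tau>" using assms by (simp add: enforces_def)
  show ?thesis
    unfolding welfare_start[OF \<tau>] reply_value_1 reply_value_0[of M]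
    using assms corr_profile_moves(1)[OF \<tau>]
    by (intro expectation_eq_const) (auto simp: enforces_def move_def)
qed

lemma SPNE_enforces:
  assumes \<sigma>: "is_profile punishment_game 2 \<sigma>" and enf: "enforces (indep punishment_game \<sigma>) a v"
  shows "is_SPNE punishment_game (punishment_rewards M) 2 (phase 0) \<sigma>"
proof -
  let ?C = "punishment_game" and ?r = "punishment_rewards M"
  have "expected ?C (indep ?C (\<sigma>(i := \<sigma>'))) 2 h (total_reward ?r i)
      \<le> expected ?C (indep ?C \<sigma>) 2 h (total_reward ?r i)"
    if i: "i < 2" and \<sigma>': "\<sigma>' \<in> strategies ?C 2 i" and l: "l < 2"
      and h: "h \<in> hist_from ?C (phase 0) l" for i \<sigma>' l h
  proof -
    let ?\<tau> = "indep ?C \<sigma>" and ?\<tau>' = "indep ?C (\<sigma>(i := \<sigma>'))"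
    have "is_profile ?C 2 (\<sigma>(i := \<sigma>'))"
      using \<sigma> \<sigma>' by (auto simp: is_profile_def)
    then have \<tau>': "is_corr_profile ?C 2 ?\<tau>'" by (rule indep_corr_profile)
    have \<tau>: "is_corr_profile ?C 2 ?\<tau>" using \<sigma> by (rule indep_corr_profile)
    have nth: "measure_pmf.expectation (indep ?C \<rho> h) (\<lambda>\<beta>. f (\<beta> ! j)) =
        measure_pmf.expectation (\<rho> j h) f" if "j < 2" for \<rho> h j and f :: "act \<Rightarrow> real"
      using that by (simp add: indep_def expectation_nth_joint_pmf)
    \<comment> \<open>Agent 0 is paid according to the unchanged strategy of agent 1, and agent 1 is
      paid a constant. A unilateral deviation therefore leaves the deviator's continuation values as
      they were, and only the first move remains to be compared.\<close>
    have stage1: "measure_pmf.expectation (?\<tau>' h) (\<lambda>\<beta>. pay M i x (\<beta> ! 1)) =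
        measure_pmf.expectation (?\<tau> h) (\<lambda>\<beta>. pay M i x (\<beta> ! 1))" for h x
      using i nth[of 1 _ h "pay M 0 x"] by (auto simp: less_two_iff pay_1[simplified])
    then have reply: "reply_value M ?\<tau>' i = reply_value M ?\<tau> i"
      by (simp add: reply_value_def fun_eq_iff)
    show ?thesis
    proof (cases "l = 0")
      case True
      then have h: "h = start" using h by (simp add: hist_from_0)
      show ?thesis
      proof (cases "i = 0")
        case True
        have "measure_pmf.expectation (?\<tau>' start) (reply_value M ?\<tau> 0) \<le> v"
          using corr_profile_moves(1)[OF \<tau>'] finite_moves enf
          by (intro expectation_le_const)
             (auto simp: enforces_def reply_value_0[of M] subset_eq intro: finite_subset)
        moreover have "measure_pmf.expectation (?\<tau> start) (reply_value M ?\<tau> 0) = v"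
          using corr_profile_moves(1)[OF \<tau>] enf
          by (intro expectation_eq_const) (auto simp: enforces_def reply_value_0[of M] subset_eq)
        ultimately show ?thesis
          using reply True expected_first[OF \<tau>, of M i] expected_first[OF \<tau>', of M i] by (simp add: h)
      next
        case False
        then have "i = 1" using i by simp
        then show ?thesis
          \<comment> \<open>The expected reward of agent 1 is determined by the first move of agent
            0, whose marginal is the same in both profiles.\<close>
          using nth[of 0 "\<sigma>(1 := \<sigma>')" start "\<lambda>a. if move 0 a = 2 then M + 2 else 0"]
            nth[of 0 \<sigma> start "\<lambda>a. if move 0 a = 2 then M + 2 else 0"]
            expected_first[OF \<tau>, of M i] expected_first[OF \<tau>', of M i]
          by (simp add: h reply_value_1[abs_def, simplified])
      qed
    next
      case False
      then have "l = 1" using l by simp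
      then obtain \<alpha> where "h = after \<alpha>" using h hist_from_1 by auto
      then show ?thesis
        by (simp add: expected_last stage1[simplified])
    qed
  qed
  then show ?thesis using \<sigma> by (auto simp: is_SPNE_def)
qed

lemma SPCE_enforces:
  assumes enf: "enforces \<tau> a v"
  shows "is_SPCE punishment_game (punishment_rewards M) 2 (phase 0) \<tau>"
proof -
  let ?C = "punishment_game" and ?r = "punishment_rewards M"
  have \<tau>: "is_corr_profile ?C 2 \<tau>" using enf by (simp add: enforces_def)
  have "expected_dev ?C \<tau> 2 h (total_reward ?r i) i b b'
      \<le> expected_dev ?C \<tau> 2 h (total_reward ?r i) i b b"
    if i: "i < 2" and l: "l < 2" and h: "h \<in> hist_from ?C (phase 0) l"
      and b: "b \<in> {Some 0, Some 1}" "b' \<in> {Some 0, Some 1}" and rec: "recommends (\<tau> h) i b"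
    for i l h b b'
  proof (cases "l = 0")
    case True
    then have h: "h = start" using h by (simp add: hist_from_0)
    \<comment> \<open>Deviations stay within \<open>moves\<close>, where \<open>enforces\<close>
      bounds the continuation value by \<open>v\<close>.\<close>
    have dev: "set_pmf (deviate (\<tau> start) i b c) \<subseteq> moves" if "c \<in> {Some 0, Some 1}" for c
      using corr_profile_moves(1)[OF \<tau>] that rec
      by (auto simp: h set_pmf_deviate moves_def nth_list_update subset_eq i)
    note first = expected_dev_first[OF \<tau> dev]
    show ?thesis
    proof (cases "i = 0")
      case True
      have "measure_pmf.expectation (deviate (\<tau> start) 0 b b') (reply_value M \<tau> 0) \<le> v"
        using dev[OF b(2)] finite_moves enf True
        by (intro expectation_le_const)
           (auto simp: enforces_def reply_value_0[of M] subset_eq intro: finite_subset)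
      moreover have "measure_pmf.expectation (deviate (\<tau> start) 0 b b) (reply_value M \<tau> 0) = v"
      proof (rule expectation_eq_const)
        fix \<alpha> assume \<alpha>: "\<alpha> \<in> set_pmf (deviate (\<tau> start) 0 b b)"
        then have "\<alpha> \<in> moves" using dev[OF b(1)] True by auto
        \<comment> \<open>Overwriting coordinate 0 with the value it already has changes nothing, so
          obedience stays in the support of \<open>\<tau> start\<close>.\<close>
        moreover have "\<alpha> \<in> set_pmf (\<tau> start)"
          using \<alpha> rec True by (auto simp: h set_pmf_deviate)
        ultimately show "reply_value M \<tau> 0 \<alpha> = v"
          using enf by (auto simp: enforces_def reply_value_0[of M])
      qed
      ultimately show ?thesis using True first[OF b(1), of M] first[OF b(2), of M] by (simp add: h)
    next
      case False
      then have "i = 1" using i by simp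
      then show ?thesis
        using expectation_deviate_other[of 1 0 "\<tau> start" b b' "\<lambda>a. if move 0 a = 2 then M + 2 else 0"]
          first[OF b(1), of M] first[OF b(2), of M]
        by (simp add: h reply_value_1[abs_def, simplified])
    qed
  next
    case False
    then have "l = 1" using l by simp
    then obtain \<alpha> where h: "h = after \<alpha>" using h hist_from_1 by auto
    show ?thesis
    proof (cases "i = 0")
      case True
      then show ?thesis
        using expectation_deviate_other[of 0 1 "\<tau> h" b b' "pay M 0 (move 0 (\<alpha> ! 0))"]
        by (simp add: h expected_dev_last)
    next
      case False
      then show ?thesis by (simp add: h expected_dev_last pay_def)
    qed
  qed
  then show ?thesis using \<tau> by (auto simp: is_SPCE_def)
qed

text \<open>Everybody always plays \<open>Some 0\<close>: agent 0 moves to phase 2, and in phase 1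
  agent 1 would inflict the reward -1, below the 0 of phase 2. The last conjunct lets the same
  profile serve as a correlated equilibrium.\<close>

lemma punishing_profile:
  "\<exists>\<sigma>. is_SPNE punishment_game (punishment_rewards M) 2 (phase 0) \<sigma> \<and>
    welfare punishment_game (punishment_rewards M) 2 start (indep punishment_game \<sigma>) = M + 2 \<and>
    enforces (indep punishment_game \<sigma>) (Some 0) 0"
proof -
  define \<sigma> :: "nat \<Rightarrow> run \<Rightarrow> act pmf" where "\<sigma> = (\<lambda>i h. return_pmf (Some 0))"
  have \<tau>: "indep punishment_game \<sigma> = (\<lambda>h. return_pmf [Some 0, Some 0])"
    by (auto simp: indep_def \<sigma>_def joint_pmf_return_pmf numeral_2_eq_2)
  have \<sigma>: "is_profile punishment_game 2 \<sigma>"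
    by (auto simp: is_profile_def strategies_def \<sigma>_def)
  have "enforces (indep punishment_game \<sigma>) (Some 0) 0"
    using indep_corr_profile[OF \<sigma>] by (auto simp: enforces_def \<tau> reply_value_def pay_def move_def)
  then show ?thesis using SPNE_enforces[OF \<sigma>] welfare_enforces by fastforce
qed


subsection \<open>Backward induction\<close>

text \<open>Here \<open>sel\<close> stands for a solver of either type, reduced to the joint
  distributions it selects.\<close>

context
  fixes sel :: "run \<Rightarrow> nfg \<Rightarrow> joint_act pmf" and M :: real
  assumes sel: "\<And>h G c g. controlled G c g \<Longrightarrow> optimal G c g (sel h G)"
begin

lemma controlled_last:
  assumes "lst h = phase x"
  shows "controlled (induced punishment_game (punishment_rewards M)
    (gbi_values sel punishment_game (punishment_rewards M) 0) h) 1 (\<lambda>i. pay M i x)"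
  using assms by (simp add: controlled_def induced_def punishment_rewards_def)

text \<open>In phase 1 agent 1 is indifferent, so all its actions are rational and welfare is the
  reward of agent 0; optimality forces the reward 1. In all other cases the reward ignores the
  action.\<close>

lemma value_last:
  fixes h x
  defines "G \<equiv> induced punishment_game (punishment_rewards M)
    (gbi_values sel punishment_game (punishment_rewards M) 0) h"
  assumes h: "lst h = phase x" and i: "i < 2"
  shows "measure_pmf.expectation (sel h G) (\<lambda>\<alpha>. pay M i x (\<alpha> ! 1)) = pay M i x (Some 1)"
proof (cases "x = 1 \<and> i = 0")
  case True
  have ctl: "controlled G 1 (\<lambda>i. pay M i 1)"
    using controlled_last[OF h] True by (simp add: G_def)
  have G: "players G = 2" "choices G j = {Some 0, Some 1}" for j
    by (simp_all add: G_def induced_def)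
  have opt: "optimal G 1 (\<lambda>i. pay M i 1) (sel h G)" using sel[OF ctl] .
  have payoff: "nfg_welfare G \<kappa> = measure_pmf.expectation \<kappa> (\<lambda>\<alpha>. pay M 0 1 (\<alpha> ! 1))" for \<kappa>
    using nfg_payoff_controlled[OF ctl] G by (simp add: nfg_welfare_def numeral_2_eq_2 pay_def)
  \<comment> \<open>This pure outcome attains the largest possible welfare 1 and bounds the selected
    welfare from below.\<close>
  have "rational G 1 (\<lambda>i. pay M i 1) (return_pmf [Some 0, Some 1])"
    by (auto simp: rational_def outcomes_def G argmax_on_def pay_def less_two_iff)
  then have "nfg_welfare G (return_pmf [Some 0, Some 1]) \<le> nfg_welfare G (sel h G)"
    using opt by (auto simp: optimal_def)
  moreover have "measure_pmf.expectation (sel h G) (\<lambda>\<alpha>. pay M 0 1 (\<alpha> ! 1)) \<le> 1"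
    using opt finite_rational[OF ctl] by (intro expectation_le_const) (auto simp: optimal_def pay_def)
  ultimately show ?thesis using True by (simp add: payoff) (simp add: pay_def)
next
  case False
  then show ?thesis by (auto simp: pay_def)
qed

lemma gbi_values_last:
  assumes "lst h = phase x" and "i < 2"
  shows "gbi_values sel punishment_game (punishment_rewards M) (Suc 0) h i = pay M i x (Some 1)"
  using value_last[OF assms] nfg_payoff_controlled[OF controlled_last[OF assms(1)]] assms(2)
  by (simp add: Let_def induced_def)

text \<open>In phase 0 nothing is paid and agent 0 determines the continuation; in the absorbing
  phases agent 1 determines the pay. The latter occur at this stage because profiles must be legal
  on histories from every initial state.\<close>

lemma controlled_first:
  assumes "lst h = phase x"
  shows "controlled (induced punishment_game (punishment_rewards M)
    (gbi_values sel punishment_game (punishment_rewards M) (Suc 0)) h)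
    (if x = 0 then 0 else 1) (\<lambda>i b. pay M i x b + pay M i (move x b) (Some 1))"
proof -
  have succ: "succ_via punishment_game h \<alpha> = {append_step h \<alpha> (phase (move x (\<alpha> ! 0)))}" for \<alpha>
    using assms by (simp add: succ_via_def next_state_phase indicator_def del: split_paired_Ex)
  have last: "lst (append_step h \<alpha> s') = s'" for \<alpha> s'
    by (simp add: lst_def stage_def st_def append_step_def)
  have val: "(\<Sum>h'\<in>succ_via punishment_game h \<alpha>.
        pmf (next_state punishment_game (lst h) \<alpha>) (lst h') *
        gbi_values sel punishment_game (punishment_rewards M) (Suc 0) h' i) =
      pay M i (move x (\<alpha> ! 0)) (Some 1)" if "i < 2" for i \<alpha>
    unfolding succ using that assms by (simp add: last next_state_phase gbi_values_last del: gbi_values.simps)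
  have util: "util (induced punishment_game (punishment_rewards M)
        (gbi_values sel punishment_game (punishment_rewards M) (Suc 0)) h) i \<alpha> =
      pay M i x (\<alpha> ! 1) + pay M i (move x (\<alpha> ! 0)) (Some 1)" if "i < 2" for i \<alpha>
    unfolding induced_def nfg.simps val[OF that] by (simp add: punishment_rewards_def assms)
  have "players (induced punishment_game r V h) = 2"
    "choices (induced punishment_game r V h) i = {Some 0, Some 1}" for r V i
    by (simp_all add: induced_def)
  then show ?thesis
    by (simp add: controlled_def util del: gbi_values.simps) (simp add: move_def pay_def)
qed

lemma gbi_game_controlled:
  assumes "h \<in> hist punishment_game l" "l < 2"
  shows "\<exists>c g. controlled (gbi_game sel punishment_game (punishment_rewards M) 2 h) c g"
proof -
  obtain x where x: "lst h = phase x" "stage h = l" using hist_lst[OF assms(1)] .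
  have "2 - stage h - 1 = Suc 0 \<or> 2 - stage h - 1 = 0" using assms(2) x(2) by auto
  then show ?thesis
  proof
    assume "2 - stage h - 1 = Suc 0"
    then show ?thesis unfolding gbi_game_def using controlled_first[OF x(1)] by (intro exI) (simp del: gbi_values.simps)
  next
    assume "2 - stage h - 1 = 0"
    then show ?thesis unfolding gbi_game_def using controlled_last[OF x(1)] by (intro exI) (simp del: gbi_values.simps)
  qed
qed

lemma gbi_enforces:
  "enforces (\<lambda>h. sel h (gbi_game sel punishment_game (punishment_rewards M) 2 h)) (Some 1) 1"
proof -
  define \<tau> where "\<tau> = (\<lambda>h. sel h (gbi_game sel punishment_game (punishment_rewards M) 2 h))"
  have game: "players (gbi_game sel punishment_game (punishment_rewards M) 2 h) = 2"
    "choices (gbi_game sel punishment_game (punishment_rewards M) 2 h) j = {Some 0, Some 1}" for h j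
    by (simp_all add: gbi_game_def induced_def)
  have "set_pmf (\<tau> h) \<subseteq> moves" if h: "h \<in> hist punishment_game l" "l < 2" for h l
  proof -
    obtain c g where "controlled (gbi_game sel punishment_game (punishment_rewards M) 2 h) c g"
      using gbi_game_controlled[OF h] by blast
    from sel[OF this, of h] show ?thesis
      by (auto simp: \<tau>_def optimal_def rational_def outcomes_def game moves_def)
  qed
  then have corr: "is_corr_profile punishment_game 2 \<tau>" by (simp add: is_corr_profile_def)
  have "\<alpha> ! 0 = Some 1" if "\<alpha> \<in> set_pmf (\<tau> start)" for \<alpha>
  proof -
    \<comment> \<open>With the reply \<open>Some 1\<close> anticipated, \<open>Some 1\<close> is
      worth 1 to agent 0 and \<open>Some 0\<close> is worth 0, so the maximiser is unique.\<close>
    have "optimal (gbi_game sel punishment_game (punishment_rewards M) 2 start) 0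
        (\<lambda>i b. pay M i 0 b + pay M i (move 0 b) (Some 1)) (\<tau> start)"
      using sel[OF controlled_first[of start 0], of start]
      by (simp add: \<tau>_def gbi_game_def del: gbi_values.simps)
    then show ?thesis
      using that
      by (auto simp: optimal_def rational_def game argmax_on_def pay_def move_def split: if_splits)
  qed
  moreover have "reply_value M \<tau> 0 \<alpha> = pay M 0 (move 0 (\<alpha> ! 0)) (Some 1)" for \<alpha>
    using value_last[of "after \<alpha>" "move 0 (\<alpha> ! 0)" 0]
    by (simp add: reply_value_def \<tau>_def gbi_game_def)
  then have "reply_value 0 \<tau> 0 \<alpha> = pay M 0 (move 0 (\<alpha> ! 0)) (Some 1)" for \<alpha>
    by (simp flip: reply_value_0[of M])
  ultimately show ?thesis
    using corr by (auto simp: enforces_def pay_def move_def simp flip: \<tau>_def)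
qed

end

text \<open>The game, the horizon 2 and the initial phase 0 are the same for all solvers and all
  \<open>M\<close>; only the rewards vary with \<open>M\<close>.\<close>

theorem lemma8:
  "(\<forall>sol. is_SWNE_solver sol \<longrightarrow>
     (\<forall>M::real. M > 0 \<longrightarrow>
       (\<exists>C r K s. is_nscsg C \<and> K \<ge> 1 \<and> s \<in> gstates C \<and>
          is_SPNE C r K s (GBI_NE sol C r K) \<and>
          (\<exists>\<sigma>. is_SW_SPNE C r K s \<sigma>) \<and>
          (\<forall>\<sigma>. is_SW_SPNE C r K s \<sigma> \<longrightarrow>
             welfare C r K (s, []) (indep C \<sigma>)
               - welfare C r K (s, []) (indep C (GBI_NE sol C r K)) > M)))) \<and>
   (\<forall>sol. is_SWCE_solver sol \<longrightarrow>
     (\<forall>M::real. M > 0 \<longrightarrow>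
       (\<exists>C r K s. is_nscsg C \<and> K \<ge> 1 \<and> s \<in> gstates C \<and>
          is_SPCE C r K s (GBI_CE sol C r K) \<and>
          (\<exists>\<tau>. is_SW_SPCE C r K s \<tau>) \<and>
          (\<forall>\<tau>. is_SW_SPCE C r K s \<tau> \<longrightarrow>
             welfare C r K (s, []) \<tau> - welfare C r K (s, []) (GBI_CE sol C r K) > M))))"
proof (intro conjI allI impI)
  fix sol and M :: real
  assume sol: "is_SWNE_solver sol" and M: "M > 0"
  let ?C = "punishment_game" and ?r = "punishment_rewards M"
  let ?sel = "\<lambda>h G. nfg_indep G (sol h G)" and ?\<sigma> = "GBI_NE sol punishment_game (punishment_rewards M) 2"
  have sel: "optimal G c g (?sel h G)" if "controlled G c g" for h G c g
    using SWNE_solver_optimal(1)[OF that sol] .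
  \<comment> \<open>Independent play of the GBI strategies is the selection \<open>?sel\<close> made
    in each induced game, so \<open>gbi_enforces\<close> applies.\<close>
  have "indep ?C ?\<sigma> = (\<lambda>h. ?sel h (gbi_game ?sel ?C ?r 2 h))"
    by (simp add: indep_def GBI_NE_def nfg_indep_def gbi_game_def induced_def fun_eq_iff)
  then have enf: "enforces (indep ?C ?\<sigma>) (Some 1) 1" using gbi_enforces[of ?sel, OF sel] by simp
  \<comment> \<open>The previous fact concerns joint distributions; legality of the individual
    strategies comes from the Nash property of the solver's choice.\<close>
  have "set_pmf (?\<sigma> i h) \<subseteq> {Some 0, Some 1}" if h: "h \<in> hist ?C l" "l < 2" and i: "i < 2" for i h l
  proof -
    obtain c g where "controlled (gbi_game ?sel ?C ?r 2 h) c g"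
      using gbi_game_controlled[of ?sel, OF sel h] by blast
    from SWNE_solver_optimal(2)[OF this sol, of h] i show ?thesis
      by (auto simp: is_NE_def GBI_NE_def gbi_game_def induced_def)
  qed
  then have prof: "is_profile ?C 2 ?\<sigma>" by (simp add: is_profile_def strategies_def)
  obtain \<sigma> where \<sigma>: "is_SPNE ?C ?r 2 (phase 0) \<sigma>" "welfare ?C ?r 2 start (indep ?C \<sigma>) = M + 2"
    using punishing_profile by blast
  have "is_SW_SPNE ?C ?r 2 (phase 0) \<sigma>"
    using \<sigma> welfare_start_le[OF indep_corr_profile M] by (auto simp: is_SW_SPNE_def is_SPNE_def)
  \<comment> \<open>Every SW-SPNE has welfare at least \<open>M + 2\<close>, that of the punishing
    profile, and GBI yields 1, so the gap is at least \<open>M + 1\<close>.\<close>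
  moreover have "M < welfare ?C ?r 2 start (indep ?C \<sigma>') - welfare ?C ?r 2 start (indep ?C ?\<sigma>)"
    if "is_SW_SPNE ?C ?r 2 (phase 0) \<sigma>'" for \<sigma>'
    using that \<sigma> welfare_enforces[OF enf] by (force simp: is_SW_SPNE_def)
  ultimately show "\<exists>C r K s. is_nscsg C \<and> K \<ge> 1 \<and> s \<in> gstates C \<and>
      is_SPNE C r K s (GBI_NE sol C r K) \<and> (\<exists>\<sigma>. is_SW_SPNE C r K s \<sigma>) \<and>
      (\<forall>\<sigma>. is_SW_SPNE C r K s \<sigma> \<longrightarrow> welfare C r K (s, []) (indep C \<sigma>)
         - welfare C r K (s, []) (indep C (GBI_NE sol C r K)) > M)"
    using is_nscsg_punishment_game SPNE_enforces[OF prof enf]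
    by (intro exI[of _ ?C] exI[of _ ?r] exI[of _ 2] exI[of _ "phase 0"])
       (auto simp: gstates_punishment_game)
next
  fix sol and M :: real
  assume sol: "is_SWCE_solver sol" and M: "M > 0"
  let ?C = "punishment_game" and ?r = "punishment_rewards M"
  have sel: "optimal G c g (sol h G)" if "controlled G c g" for h G c g
    using SWCE_solver_optimal[OF that sol] .
  have enf: "enforces (GBI_CE sol ?C ?r 2) (Some 1) 1"
    using gbi_enforces[of sol, OF sel] by (simp add: GBI_CE_def)
  obtain \<sigma> where \<sigma>: "welfare ?C ?r 2 start (indep ?C \<sigma>) = M + 2"
      "enforces (indep ?C \<sigma>) (Some 0) 0"
    using punishing_profile by blast
  have SP: "is_SPCE ?C ?r 2 (phase 0) (indep ?C \<sigma>)" using SPCE_enforces[OF \<sigma>(2)] .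
  then have "is_SW_SPCE ?C ?r 2 (phase 0) (indep ?C \<sigma>)"
    using \<sigma>(1) welfare_start_le[OF _ M] by (auto simp: is_SW_SPCE_def is_SPCE_def)
  moreover have "M < welfare ?C ?r 2 start \<tau> - welfare ?C ?r 2 start (GBI_CE sol ?C ?r 2)"
    if "is_SW_SPCE ?C ?r 2 (phase 0) \<tau>" for \<tau>
    using that \<sigma>(1) SP welfare_enforces[OF enf] by (force simp: is_SW_SPCE_def)
  ultimately show "\<exists>C r K s. is_nscsg C \<and> K \<ge> 1 \<and> s \<in> gstates C \<and>
      is_SPCE C r K s (GBI_CE sol C r K) \<and> (\<exists>\<tau>. is_SW_SPCE C r K s \<tau>) \<and>
      (\<forall>\<tau>. is_SW_SPCE C r K s \<tau> \<longrightarrow>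
         welfare C r K (s, []) \<tau> - welfare C r K (s, []) (GBI_CE sol C r K) > M)"
    using is_nscsg_punishment_game SPCE_enforces[OF enf]
    by (intro exI[of _ ?C] exI[of _ ?r] exI[of _ 2] exI[of _ "phase 0"])
       (auto simp: gstates_punishment_game)
qed

end
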